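(* Let $p$ be a prime and let $\nu$ be a positive integer. Let $n$ be a positive integer such that $p\nmid n$. Then, for all integers $k\ge 0$, the number of Euclidean complementary dual cyclic codes of length $np^k$ over $\mathbb{F}_{p^\nu}$ equals the number of Euclidean complementary dual cyclic codes of length $n$ over $\mathbb{F}_{p^\nu}$, which is $$2^{\sum_{d\mid n}\chi(d,p^\nu)\frac{\Phi(d)}{\mathrm{ord}_d(p^\nu)}+\frac12\sum_{d\mid n}\left(1-\chi(d,p^\nu)\right)\frac{\Phi(d)}{\mathrm{ord}_d(p^\nu)}},$$ where $\Phi$ is the Euler totient function.
   Context: A cyclic code of length $m$ over a finite field $F$ is an ideal of the group algebra $F[\mathbb{Z}_m]\cong F[X]/(X^m-1)$, regarded as a subspace of $F^m$. With $\langle u,v\rangle_{\rm E}=\sum_i u_iv_i$ and $C^{\perp_{\rm E}}=\{v : \langle c,v\rangle_{\rm E}=0\ \forall c\in C\}$, a code $C$ is Euclidean complementary dual if $C\cap C^{\perp_{\rm E}}=\{0\}$. $\mathrm{ord}_d(m)$ denotes the multiplicative order of $m$ modulo $d$ (equal to $1$ for $d=1$). $\chi(d,p^\nu)=1$ if there exists a positive integer $i$ such that $d\mid (p^{\nu i}+1)$, and $\chi(d,p^\nu)=0$ otherwise. *)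

theory Defs
  imports
    "Jordan_Normal_Form.Matrix"
    "HOL-Algebra.Ideal"
    "HOL-Number_Theory.Number_Theory"
begin

text \<open>
  The group algebra \<open>F[\<int>\<^sub>m]\<close>: the basis element of the residue \<open>i\<close> is the \<open>i\<close>-th unit
  vector of \<open>F\<^sup>m\<close>, so the carrier is \<open>F\<^sup>m\<close> itself and multiplication is cyclic convolution.
\<close>

definition cyclic_conv :: "nat \<Rightarrow> 'a::comm_ring_1 vec \<Rightarrow> 'a vec \<Rightarrow> 'a vec" where
  "cyclic_conv m u v =
     vec m (\<lambda>k. \<Sum>i<m. \<Sum>j\<in>{j. j < m \<and> (i + j) mod m = k}. u $ i * v $ j)"

definition cyclic_group_algebra :: "'a::comm_ring_1 itself \<Rightarrow> nat \<Rightarrow> 'a vec ring" where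
  "cyclic_group_algebra F m =
     \<lparr>carrier = carrier_vec m, mult = cyclic_conv m, one = unit_vec m 0,
      zero = 0\<^sub>v m, add = (+)\<rparr>"

text \<open>
  The library predicate \<open>ideal\<close> includes that the ambient structure is a ring;
  the next lemmas show that this holds for \<open>m > 0\<close>.
\<close>

lemma cyclic_conv_carrier: "cyclic_conv m u v \<in> carrier_vec m"
  by (simp add: cyclic_conv_def)

lemma cyclic_conv_index:
  assumes "k < m"
  shows "cyclic_conv m u v $ k = (\<Sum>i<m. \<Sum>j<m. if (i + j) mod m = k then u $ i * v $ j else 0)"
  using assms unfolding cyclic_conv_def
  by (auto intro!: sum.cong simp: sum.inter_filter[symmetric] lessThan_def)

lemma cyclic_conv_unit:
  assumes "u \<in> carrier_vec m"
  shows "cyclic_conv m (unit_vec m 0) u = u"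
proof (rule eq_vecI)
  fix k assume "k < dim_vec u"
  hence k: "k < m" using assms by simp
  have "cyclic_conv m (unit_vec m 0) u $ k =
      (\<Sum>i<m. if i = 0 then u $ k else 0)"
    unfolding cyclic_conv_index[OF k]
  proof (rule sum.cong[OF refl])
    fix i assume i: "i \<in> {..<m}"
    have "(\<Sum>j<m. if (i + j) mod m = k then unit_vec m 0 $ i * u $ j else 0)
        = (\<Sum>j<m. if j = k then (if i = 0 then u $ k else 0) else 0)"
      using i k by (intro sum.cong) auto
    thus "(\<Sum>j<m. if (i + j) mod m = k then unit_vec m 0 $ i * u $ j else 0)
        = (if i = 0 then u $ k else 0)"
      using k by simp
  qed
  thus "cyclic_conv m (unit_vec m 0) u $ k = u $ k" using k by simp
qed (use assms in \<open>simp add: cyclic_conv_def\<close>)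

lemma cyclic_conv_commute: "cyclic_conv m u v = cyclic_conv m v u"
proof (rule eq_vecI)
  fix k assume "k < dim_vec (cyclic_conv m v u)"
  hence k: "k < m" by (simp add: cyclic_conv_def)
  show "cyclic_conv m u v $ k = cyclic_conv m v u $ k"
    unfolding cyclic_conv_index[OF k]
    by (subst sum.swap) (intro sum.cong refl if_cong; simp add: ac_simps)
qed (simp add: cyclic_conv_def)

lemma cyclic_conv_add:
  assumes "u \<in> carrier_vec m" "v \<in> carrier_vec m"
  shows "cyclic_conv m (u + v) w = cyclic_conv m u w + cyclic_conv m v w"
proof (rule eq_vecI)
  fix k assume "k < dim_vec (cyclic_conv m u w + cyclic_conv m v w)"
  hence k: "k < m" by (simp add: cyclic_conv_def)
  have [simp]: "dim_vec (cyclic_conv m v w) = m" by (simp add: cyclic_conv_def)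
  show "cyclic_conv m (u + v) w $ k = (cyclic_conv m u w + cyclic_conv m v w) $ k"
    using assms k
    by (auto simp: cyclic_conv_index sum.distrib[symmetric] algebra_simps intro!: sum.cong)
qed (simp add: cyclic_conv_def)

lemma cyclic_conv_conv_index:
  assumes "l < m"
  shows "cyclic_conv m (cyclic_conv m u v) w $ l =
    (\<Sum>i<m. \<Sum>j<m. \<Sum>k<m. if (i + j + k) mod m = l then u $ i * v $ j * w $ k else 0)"
proof -
  have "cyclic_conv m (cyclic_conv m u v) w $ l =
    (\<Sum>s<m. \<Sum>k<m. \<Sum>i<m. \<Sum>j<m.
       if (i + j) mod m = s then (if (s + k) mod m = l then u $ i * v $ j * w $ k else 0) else 0)"
    unfolding cyclic_conv_index[OF assms]
    by (intro sum.cong refl) (auto simp: cyclic_conv_index sum_distrib_right intro!: sum.cong sum.neutral)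
  also have "\<dots> = (\<Sum>k<m. \<Sum>i<m. \<Sum>j<m. \<Sum>s<m.
       if (i + j) mod m = s then (if (s + k) mod m = l then u $ i * v $ j * w $ k else 0) else 0)"
    by (subst sum.swap, rule sum.cong[OF refl], subst sum.swap, rule sum.cong[OF refl],
        rule sum.swap)
  also have "\<dots> = (\<Sum>k<m. \<Sum>i<m. \<Sum>j<m.
       if (i + j + k) mod m = l then u $ i * v $ j * w $ k else 0)"
    by (intro sum.cong refl) (auto simp: mod_add_left_eq)
  also have "\<dots> = (\<Sum>i<m. \<Sum>j<m. \<Sum>k<m.
       if (i + j + k) mod m = l then u $ i * v $ j * w $ k else 0)"
    by (subst sum.swap, rule sum.cong[OF refl], rule sum.swap)
  finally show ?thesis .
qed

lemma cyclic_conv_assoc: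
  "cyclic_conv m (cyclic_conv m u v) w = cyclic_conv m u (cyclic_conv m v w)"
proof (rule eq_vecI)
  fix l assume "l < dim_vec (cyclic_conv m u (cyclic_conv m v w))"
  hence l: "l < m" by (simp add: cyclic_conv_def)
  have "cyclic_conv m (cyclic_conv m v w) u $ l =
    (\<Sum>j<m. \<Sum>k<m. \<Sum>i<m. if (j + k + i) mod m = l then v $ j * w $ k * u $ i else 0)"
    by (rule cyclic_conv_conv_index[OF l])
  also have "\<dots> = (\<Sum>j<m. \<Sum>i<m. \<Sum>k<m. if (j + k + i) mod m = l then v $ j * w $ k * u $ i else 0)"
    by (rule sum.cong[OF refl], rule sum.swap)
  also have "\<dots> = (\<Sum>i<m. \<Sum>j<m. \<Sum>k<m. if (j + k + i) mod m = l then v $ j * w $ k * u $ i else 0)"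
    by (rule sum.swap)
  also have "\<dots> = (\<Sum>i<m. \<Sum>j<m. \<Sum>k<m. if (i + j + k) mod m = l then u $ i * v $ j * w $ k else 0)"
    by (intro sum.cong refl if_cong) (simp_all add: ac_simps)
  finally show "cyclic_conv m (cyclic_conv m u v) w $ l = cyclic_conv m u (cyclic_conv m v w) $ l"
    by (simp only: cyclic_conv_conv_index[OF l] cyclic_conv_commute[of m u "cyclic_conv m v w"])
qed (simp add: cyclic_conv_def)

lemma cring_cyclic_group_algebra:
  assumes "m > 0"
  shows "cring (cyclic_group_algebra TYPE('a::comm_ring_1) m)"
proof (rule cringI)
  let ?R = "cyclic_group_algebra TYPE('a) m"
  show "abelian_group ?R"
  proof (rule abelian_groupI)
    fix x assume "x \<in> carrier ?R"
    thus "\<exists>y\<in>carrier ?R. y \<oplus>\<^bsub>?R\<^esub> x = \<zero>\<^bsub>?R\<^esub>"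
      by (intro bexI[of _ "- x"]) (auto simp: cyclic_group_algebra_def)
  qed (auto simp: cyclic_group_algebra_def assoc_add_vec intro: comm_add_vec)
  show "comm_monoid ?R"
    by (rule comm_monoidI)
       (auto simp: cyclic_group_algebra_def cyclic_conv_carrier cyclic_conv_assoc
          cyclic_conv_unit intro: cyclic_conv_commute)
  fix x y z assume "x \<in> carrier ?R" "y \<in> carrier ?R" "z \<in> carrier ?R"
  thus "(x \<oplus>\<^bsub>?R\<^esub> y) \<otimes>\<^bsub>?R\<^esub> z = x \<otimes>\<^bsub>?R\<^esub> z \<oplus>\<^bsub>?R\<^esub> y \<otimes>\<^bsub>?R\<^esub> z"
    by (simp add: cyclic_group_algebra_def cyclic_conv_add)
qed

definition cyclic_code :: "nat \<Rightarrow> 'a::field vec set \<Rightarrow> bool" where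
  "cyclic_code m C \<longleftrightarrow> ideal C (cyclic_group_algebra TYPE('a) m)"

definition euclidean_dual :: "nat \<Rightarrow> 'a::field vec set \<Rightarrow> 'a vec set" where
  "euclidean_dual m C = {v \<in> carrier_vec m. \<forall>c\<in>C. c \<bullet> v = 0}"

definition euclidean_complementary_dual :: "nat \<Rightarrow> 'a::field vec set \<Rightarrow> bool" where
  "euclidean_complementary_dual m C \<longleftrightarrow> C \<inter> euclidean_dual m C = {0\<^sub>v m}"

definition ecd_cyclic_codes :: "'a::field itself \<Rightarrow> nat \<Rightarrow> 'a vec set set" where
  "ecd_cyclic_codes F m = {C. cyclic_code m C \<and> euclidean_complementary_dual m C}"

definition chi :: "nat \<Rightarrow> nat \<Rightarrow> nat" where
  "chi d q = (if \<exists>i>0. d dvd q ^ i + 1 then 1 else 0)"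

end

theory Submission
  imports
    Defs
    "HOL-Computational_Algebra.Polynomial"
    "HOL-Algebra.Subrings"
    "HOL-Algebra.Multiplicative_Group"
begin

text \<open>
  Write \<open>*\<close> for the involution \<open>i \<mapsto> -i\<close> of \<open>R = F[\<int>\<^sub>m]\<close> and \<open>q = p\<^sup>\<nu>\<close>. The dual of an ideal \<open>C\<close> is the
  annihilator of \<open>C*\<close>. If \<open>C = gR\<close> meets it trivially, multiplication by \<open>g*\<close> is injective, hence
  surjective, on the finite set \<open>C\<close>; so \<open>g\<close> is a multiple of \<open>g g*\<close>, and \<open>C\<close> is generated by an
  idempotent fixed by \<open>*\<close>. Thus the codes correspond to the symmetric idempotents of \<open>R\<close>.

  These are the idempotents of the subring \<open>B\<close> of all \<open>x\<close> with \<open>x\<^sup>q = x = x*\<close>. Such a ring is a product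
  of copies of \<open>F\<close>, so \<open>|B| = q\<^sup>r\<close> forces \<open>2\<^sup>r\<close> idempotents. Since \<open>x\<^sup>q\<close> is the dilation of \<open>x\<close> by \<open>q\<close>,
  for \<open>m = n p\<^sup>k\<close> the elements of \<open>B\<close> are supported on the multiples of \<open>p\<^sup>k\<close>, a copy of \<open>\<int>\<^sub>n\<close>, and
  constant on the orbits of \<open>\<langle>q, -1\<rangle>\<close> there. Hence \<open>r\<close> is the number of these orbits, independently of \<open>k\<close>.
  An element of \<open>\<int>\<^sub>n\<close> of order \<open>d\<close> has an orbit of size \<open>ord\<^sub>d(q)\<close> if \<open>-1\<close> is a power of \<open>q\<close> modulo \<open>d\<close>,
  and of twice that size otherwise.
\<close>

subsection \<open>Idempotents in commutative rings\<close>

text \<open>Surjectivity of multiplication by \<open>\<sigma> g\<close> on the ideal writes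
  \<open>g\<close> as a multiple of \<open>\<sigma> g \<otimes> g\<close>. Together with the image
  of this equation under \<open>\<sigma>\<close> it makes \<open>g\<close> von Neumann regular, so
  that an idempotent generates the same ideal.\<close>

lemma (in cring) symmetric_idempotent_generator:
  assumes fin: "finite (carrier R)"
    and \<sigma>: "\<sigma> \<in> ring_hom R R" and invol: "\<And>x. x \<in> carrier R \<Longrightarrow> \<sigma> (\<sigma> x) = x"
    and g: "g \<in> carrier R"
    and ann: "\<And>y. y \<in> PIdl g \<Longrightarrow> \<sigma> g \<otimes> y = \<zero> \<Longrightarrow> y = \<zero>"
  shows "\<exists>e\<in>carrier R. e \<otimes> e = e \<and> \<sigma> e = e \<and> PIdl g = PIdl e"
proof -
  have \<sigma>c [simp]: "\<sigma> x \<in> carrier R" if "x \<in> carrier R" for x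
    using ring_hom_closed[OF \<sigma> that] .
  have \<sigma>m: "\<sigma> (x \<otimes> y) = \<sigma> x \<otimes> \<sigma> y" if "x \<in> carrier R" "y \<in> carrier R" for x y
    using ring_hom_mult[OF \<sigma> that] .
  interpret I: ideal "PIdl g" R by (rule cgenideal_ideal[OF g])
  have "inj_on ((\<otimes>) (\<sigma> g)) (PIdl g)"
  proof (rule inj_onI)
    fix x y assume x: "x \<in> PIdl g" and y: "y \<in> PIdl g" and eq: "\<sigma> g \<otimes> x = \<sigma> g \<otimes> y"
    have c: "x \<in> carrier R" "y \<in> carrier R" using x y I.Icarr by auto
    have "\<sigma> g \<otimes> (x \<ominus> y) = \<zero>"
      using c g eq by (simp add: a_minus_def r_distr r_minus r_neg)
    moreover have "x \<ominus> y \<in> PIdl g"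
      using x y by (simp add: a_minus_def)
    ultimately have "x \<ominus> y = \<zero>" by (rule ann[rotated])
    thus "x = y" using c by simp
  qed
  moreover have "(\<otimes>) (\<sigma> g) ` (PIdl g) \<subseteq> PIdl g"
    using g by (auto intro: I.I_l_closed)
  moreover have "finite (PIdl g)"
    by (rule finite_subset[OF I.a_subset fin])
  ultimately have "(\<otimes>) (\<sigma> g) ` (PIdl g) = PIdl g"
    by (intro endo_inj_surj)
  then obtain y where y: "y \<in> PIdl g" "g = \<sigma> g \<otimes> y"
    using cgenideal_self[OF g] by (metis imageE)
  then obtain r where r: "r \<in> carrier R" and gr: "g = \<sigma> g \<otimes> (r \<otimes> g)"
    unfolding cgenideal_def by blast
  define s where "s = \<sigma> r \<otimes> g"
  have s: "s \<in> carrier R" using r g by (simp add: s_def)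
  have \<sigma>g: "\<sigma> g = s \<otimes> \<sigma> g"
    using arg_cong[OF gr, of \<sigma>] r g by (simp add: \<sigma>m invol s_def m_ac)
  \<comment> \<open>Inserting \<open>\<sigma> g = s \<otimes> \<sigma> g\<close> into
    \<open>g = r \<otimes> g \<otimes> \<sigma> g\<close> produces a second factor \<open>g\<close>;
    \<open>t\<close> is the product of the remaining factors.\<close>
  define t where "t = r \<otimes> \<sigma> r \<otimes> \<sigma> g"
  have t: "t \<in> carrier R" using r g by (simp add: t_def)
  have ggt: "g \<otimes> (g \<otimes> t) = g"
  proof -
    have "g = r \<otimes> g \<otimes> (s \<otimes> \<sigma> g)"
      using gr r g \<sigma>g by (metis \<sigma>c m_assoc m_comm m_closed)
    also have "\<dots> = g \<otimes> (g \<otimes> t)"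
      using r g by (simp add: s_def t_def m_ac)
    finally show ?thesis by simp
  qed
  define e where "e = g \<otimes> t"
  have e: "e \<in> carrier R" using g t by (simp add: e_def)
  have idem: "e \<otimes> e = e"
  proof -
    have "e \<otimes> e = g \<otimes> (g \<otimes> t) \<otimes> t" using g t by (simp add: e_def m_ac)
    thus ?thesis by (simp only: ggt e_def)
  qed
  \<comment> \<open>\<open>\<sigma> e\<close> has the factor \<open>s \<otimes> \<sigma> g\<close>,
    hence the factor \<open>g\<close>, and \<open>e\<close> absorbs \<open>g\<close>. Applying
    \<open>\<sigma>\<close> then shows that \<open>\<sigma> e\<close> absorbs
    \<open>e\<close>.\<close>
  have "\<sigma> e \<otimes> e = \<sigma> e"
  proof -
    have "\<sigma> e = s \<otimes> \<sigma> g \<otimes> \<sigma> t" using g t \<sigma>g by (simp add: e_def \<sigma>m)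
    also have "\<dots> = \<sigma> r \<otimes> \<sigma> g \<otimes> \<sigma> t \<otimes> (g \<otimes> (g \<otimes> t))"
      using g t r by (simp add: s_def m_ac ggt)
    also have "\<dots> = s \<otimes> \<sigma> g \<otimes> \<sigma> t \<otimes> e"
      using g t r by (simp add: s_def e_def m_ac)
    also have "s \<otimes> \<sigma> g \<otimes> \<sigma> t = \<sigma> e" using g t \<sigma>g by (simp add: e_def \<sigma>m)
    finally show ?thesis by simp
  qed
  moreover from this have "\<sigma> (\<sigma> e \<otimes> e) = \<sigma> (\<sigma> e)" by simp
  hence "e \<otimes> \<sigma> e = e" using e by (simp add: \<sigma>m invol)
  ultimately have "\<sigma> e = e" using e by (metis m_comm \<sigma>c)
  moreover have "PIdl g = PIdl e"
  proof
    show "PIdl g \<subseteq> PIdl e"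
      by (rule cgenideal_minimal[OF cgenideal_ideal[OF e]])
         (use g ggt in \<open>unfold cgenideal_def e_def, force\<close>)
    show "PIdl e \<subseteq> PIdl g"
      by (rule cgenideal_minimal[OF cgenideal_ideal[OF g]])
         (use g t m_comm[OF g t] in \<open>unfold cgenideal_def e_def, blast\<close>)
  qed
  ultimately show ?thesis using e idem by blast
qed

lemma (in cring) idempotent_absorbs:
  assumes "e \<in> carrier R" "e \<otimes> e = e" "x \<in> PIdl e"
  shows "e \<otimes> x = x" "x \<otimes> e = x"
proof -
  obtain y where y: "y \<in> carrier R" "x = y \<otimes> e"
    using assms by (auto simp: cgenideal_def)
  thus "x \<otimes> e = x" using assms by (simp add: m_assoc)
  thus "e \<otimes> x = x" using assms y by (simp add: m_comm)
qed

text \<open>Two idempotents with the same ideal absorb each other, so both equal their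
  product.\<close>

lemma (in cring) inj_on_idempotent_cgenideal:
  "inj_on (\<lambda>e. PIdl e) {e \<in> carrier R. e \<otimes> e = e}"
proof (rule inj_onI; clarsimp)
  fix e f assume "e \<in> carrier R" "f \<in> carrier R" "e \<otimes> e = e" "f \<otimes> f = f" "PIdl e = PIdl f"
  thus "e = f"
    using idempotent_absorbs(2)[of e f] idempotent_absorbs(1)[of f e] cgenideal_self by metis
qed

text \<open>Corners are the factors split off in the induction below. Their identity is
  \<open>e\<close>, so the field \<open>one\<close> changes along with the carrier.\<close>

lemma (in cring) cring_idempotent_corner:
  assumes e: "e \<in> carrier R" "e \<otimes> e = e"
  shows "cring (R\<lparr>carrier := PIdl e, one := e\<rparr>)"
proof (rule cringI)
  interpret I: ideal "PIdl e" R by (rule cgenideal_ideal[OF e(1)])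
  let ?S = "R\<lparr>carrier := PIdl e, one := e\<rparr>"
  show "abelian_group ?S"
  proof (rule abelian_groupI)
    fix x assume "x \<in> carrier ?S"
    thus "\<exists>y\<in>carrier ?S. y \<oplus>\<^bsub>?S\<^esub> x = \<zero>\<^bsub>?S\<^esub>"
      by (intro bexI[of _ "\<ominus> x"]) (auto simp: l_neg I.Icarr)
  qed (auto simp: I.Icarr a_assoc I.a_closed intro: a_comm)
  show "comm_monoid ?S"
    by (rule comm_monoidI)
       (auto simp: I.Icarr m_assoc I.I_l_closed idempotent_absorbs[OF e] cgenideal_self[OF e(1)] intro: m_comm)
qed (auto simp: ideal.Icarr[OF cgenideal_ideal[OF e(1)]] l_distr)

text \<open>The rings to which this step is applied are products of copies of a field with \<open>q\<close>
  elements; they are split along idempotents until none but \<open>\<zero>\<close> and \<open>\<one>\<close> are left.\<close>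

lemma (in cring) card_idempotents_of_fixed_power_step:
  fixes q :: nat
  assumes IH: "\<And>S :: ('a, 'b) ring_scheme. card (carrier S) < card (carrier R) \<Longrightarrow> cring S \<Longrightarrow>
      finite (carrier S) \<Longrightarrow> (\<And>x. x \<in> carrier S \<Longrightarrow> x [^]\<^bsub>S\<^esub> q = x) \<Longrightarrow>
      (\<And>e. e \<in> carrier S \<Longrightarrow> e \<otimes>\<^bsub>S\<^esub> e = e \<Longrightarrow> e \<noteq> \<zero>\<^bsub>S\<^esub> \<Longrightarrow> q \<le> card (PIdl\<^bsub>S\<^esub> e)) \<Longrightarrow>
      \<exists>r. card (carrier S) = q ^ r \<and> card {e \<in> carrier S. e \<otimes>\<^bsub>S\<^esub> e = e} = 2 ^ r"
    and fin: "finite (carrier R)" and q: "q \<ge> 2"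
    and pow_q: "\<And>x. x \<in> carrier R \<Longrightarrow> x [^] q = x"
    and big: "\<And>e. e \<in> carrier R \<Longrightarrow> e \<otimes> e = e \<Longrightarrow> e \<noteq> \<zero> \<Longrightarrow> q \<le> card (PIdl e)"
  shows "\<exists>r. card (carrier R) = q ^ r \<and> card {e \<in> carrier R. e \<otimes> e = e} = 2 ^ r"
proof -
  have PIdl_one: "PIdl \<one> = carrier R"
  proof (intro equalityI subsetI)
    fix x assume "x \<in> carrier R"
    thus "x \<in> PIdl \<one>"
      unfolding cgenideal_def by (intro CollectI exI[of _ x]) simp
  qed (auto simp: cgenideal_def)
  let ?E = "{e \<in> carrier R. e \<otimes> e = e}"
  \<comment> \<open>The zero ring has \<open>r = 0\<close>, a ring with just the two trivial
    idempotents is a field and has \<open>r = 1\<close>, and any further idempotent splits the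
    ring.\<close>
  consider "\<one> = \<zero>" | "\<one> \<noteq> \<zero>" "?E \<subseteq> {\<zero>, \<one>}" | f where "f \<in> ?E" "f \<noteq> \<zero>" "f \<noteq> \<one>" by blast
  thus ?thesis
  proof cases
    case 1
    hence "carrier R = {\<zero>}" by (rule one_zeroD)
    moreover have "?E = {\<zero>}" using \<open>carrier R = {\<zero>}\<close> by auto
    ultimately show ?thesis by (intro exI[of _ 0]) simp
  next
    case 2
    obtain r where qr: "q = Suc (Suc r)" using q by (metis add_2_eq_Suc le_Suc_ex)
    \<comment> \<open>This power is idempotent because \<open>x [^] q = x\<close>, and nonzero for
      the same reason. The inverse of \<open>x\<close> is therefore \<open>x [^] r\<close>, with
      \<open>r = q - 2\<close>.\<close>
    have pw: "x [^] (q - 1) = \<one>" if x: "x \<in> carrier R" "x \<noteq> \<zero>" for x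
    proof -
      have "x [^] (q - 1) \<otimes> x [^] (q - 1) = x [^] r \<otimes> x [^] q"
        using x qr by (simp add: m_ac)
      also have "\<dots> = x [^] (q - 1)"
        using pow_q[OF x(1)] qr by simp
      finally have "x [^] (q - 1) \<in> {\<zero>, \<one>}" using 2 x by blast
      moreover have "x [^] (q - 1) \<noteq> \<zero>"
      proof
        assume "x [^] (q - 1) = \<zero>"
        hence "x [^] q = \<zero>" using x qr by simp
        thus False using pow_q x by simp
      qed
      ultimately show ?thesis by simp
    qed
    have "field R"
    proof (rule cring_fieldI2[OF _ ])
      show "\<zero> \<noteq> \<one>" using 2 by simp
      fix x assume x: "x \<in> carrier R" "x \<noteq> \<zero>"
      show "\<exists>y\<in>carrier R. x \<otimes> y = \<one>"
        using pw[OF x] x qr by (intro bexI[of _ "x [^] r"]) (auto simp: m_comm)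
    qed
    then interpret F: field R .
    \<comment> \<open>All nonzero elements are roots of \<open>X^(q-1) - 1\<close>, which bounds the
      field by \<open>q\<close> elements; \<open>big\<close> at \<open>\<one>\<close> gives the
      converse bound.\<close>
    have "card (carrier R - {\<zero>}) \<le> card {x \<in> carrier R. x [^] (q - 1) = \<one>}"
      by (rule card_mono) (use fin pw in auto)
    also have "\<dots> \<le> q - 1"
      by (rule F.num_roots_le_deg[OF fin]) (use q in simp)
    finally have "card (carrier R) \<le> q"
      using fin by (simp add: card_Diff_singleton) (use q in linarith)
    moreover have "q \<le> card (carrier R)"
      using big[of \<one>] 2 PIdl_one by simp
    moreover have "?E = {\<zero>, \<one>}" using 2 by auto
    ultimately show ?thesis using 2 by (intro exI[of _ 1]) simp
  next
    case (3 f)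
    define f' where "f' = \<one> \<ominus> f"
    have f: "f \<in> carrier R" "f \<otimes> f = f" using 3 by auto
    have f': "f' \<in> carrier R" using f by (simp add: f'_def)
    have ff': "f \<otimes> f' = \<zero>"
      using f by (simp add: f'_def a_minus_def r_distr r_minus r_neg)
    have sum1: "f \<oplus> f' = \<one>"
      using f by (simp add: f'_def a_minus_def) (metis a_lcomm a_inv_closed one_closed r_neg r_zero)
    have f'f': "f' \<otimes> f' = f'"
    proof -
      have "f' = (f \<oplus> f') \<otimes> f'" using sum1 f' by simp
      also have "\<dots> = f' \<otimes> f'" using f f' ff' by (simp add: l_distr)
      finally show ?thesis by simp
    qed
    have split: "x = f \<otimes> x \<oplus> f' \<otimes> x" if "x \<in> carrier R" for x
      using that f f' sum1 by (simp flip: l_distr)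
    \<comment> \<open>The witness \<open>h\<close> is killed by \<open>e\<close>, so it lies outside
      the corner. The corner is thus smaller than the ring and the induction hypothesis
      applies.\<close>
    have corner: "\<exists>r. card (PIdl e) = q ^ r \<and> card {x \<in> PIdl e. x \<otimes> x = x} = 2 ^ r"
      if e: "e \<in> carrier R" "e \<otimes> e = e" and h: "h \<in> carrier R" "e \<otimes> h = \<zero>" "h \<noteq> \<zero>" for e h
    proof -
      let ?S = "R\<lparr>carrier := PIdl e, one := e\<rparr>"
      interpret I: ideal "PIdl e" R by (rule cgenideal_ideal[OF e(1)])
      interpret S: cring ?S by (rule cring_idempotent_corner[OF e])
      have sub: "PIdl e \<subseteq> carrier R" using I.Icarr by auto
      have "h \<notin> PIdl e" using idempotent_absorbs(1)[OF e, of h] h by auto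
      hence less: "card (PIdl e) < card (carrier R)"
        using sub h fin by (intro psubset_card_mono) auto
      \<comment> \<open>The exponent is a successor because the zeroth powers differ:
        \<open>e\<close> in the corner, \<open>\<one>\<close> in the ring.\<close>
      have pow: "x [^]\<^bsub>?S\<^esub> Suc n = x [^] Suc n" if "x \<in> PIdl e" for x n
        using that idempotent_absorbs[OF e that] I.Icarr[OF that]
        by (induction n) auto
      have "\<exists>r. card (carrier ?S) = q ^ r \<and> card {x \<in> carrier ?S. x \<otimes>\<^bsub>?S\<^esub> x = x} = 2 ^ r"
      proof (rule IH[of ?S])
        fix x assume x: "x \<in> carrier ?S"
        show "x [^]\<^bsub>?S\<^esub> q = x"
          using pow[of x "q - 1"] pow_q[of x] x q I.Icarr[of x] by simp
        assume xx: "x \<otimes>\<^bsub>?S\<^esub> x = x" and x0: "x \<noteq> \<zero>\<^bsub>?S\<^esub>"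
        have xc: "x \<in> carrier R" using x sub by auto
        \<comment> \<open>By idempotence \<open>z \<otimes> x = (z \<otimes> x) \<otimes> x\<close>,
          so a multiplier from the ring can be replaced by one from the corner. This transfers
          \<open>big\<close>.\<close>
        have "PIdl\<^bsub>?S\<^esub> x = PIdl x"
        proof (intro equalityI subsetI)
          fix y assume "y \<in> PIdl x"
          then obtain z where z: "z \<in> carrier R" "y = z \<otimes> x"
            unfolding cgenideal_def by blast
          have "y = (z \<otimes> x) \<otimes> x" using z xx xc by (simp add: m_assoc)
          moreover have "z \<otimes> x \<in> PIdl e" using x z by (simp add: I.I_l_closed)
          ultimately show "y \<in> PIdl\<^bsub>?S\<^esub> x" by (auto simp: cgenideal_def[of ?S])
        next
          fix y assume "y \<in> PIdl\<^bsub>?S\<^esub> x"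
          thus "y \<in> PIdl x" using sub by (auto simp: cgenideal_def[of ?S] cgenideal_def[of R x])
        qed
        thus "q \<le> card (PIdl\<^bsub>?S\<^esub> x)" using big[of x] xc xx x0 by simp
      qed (use less S.is_cring fin sub q in \<open>auto intro: finite_subset\<close>)
      thus ?thesis by simp
    qed
    have f'0: "f' \<noteq> \<zero>" using 3 sum1 f by auto
    obtain r where r: "card (PIdl f) = q ^ r" "card {x \<in> PIdl f. x \<otimes> x = x} = 2 ^ r"
      using corner[OF f f' ff' f'0] by blast
    obtain r' where r': "card (PIdl f') = q ^ r'" "card {x \<in> PIdl f'. x \<otimes> x = x} = 2 ^ r'"
      using corner[OF f' f'f' f(1)] ff' f f' 3 by (auto simp: m_comm)
    interpret I: ideal "PIdl f" R by (rule cgenideal_ideal[OF f(1)])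
    interpret J: ideal "PIdl f'" R by (rule cgenideal_ideal[OF f'])
    have proj: "f \<otimes> (x \<oplus> y) = x" "f' \<otimes> (x \<oplus> y) = y" and prod: "x \<otimes> y = \<zero>"
      if "x \<in> PIdl f" "y \<in> PIdl f'" for x y
    proof -
      have x: "x \<in> carrier R" "f \<otimes> x = x" and y: "y \<in> carrier R" "f' \<otimes> y = y"
        using that I.Icarr J.Icarr idempotent_absorbs[OF f] idempotent_absorbs[OF f' f'f'] by auto
      have "f \<otimes> y = f \<otimes> f' \<otimes> y" using f f' y by (simp add: m_assoc)
      hence 1: "f \<otimes> y = \<zero>" using ff' y by simp
      have "f' \<otimes> x = f \<otimes> f' \<otimes> x" using f f' x by (metis m_assoc m_comm)
      hence 2: "f' \<otimes> x = \<zero>" using ff' x by simp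
      show "f \<otimes> (x \<oplus> y) = x" "f' \<otimes> (x \<oplus> y) = y"
        using 1 2 x y f f' by (auto simp: r_distr)
      have "x \<otimes> y = x \<otimes> (f \<otimes> y)" using x y f by (metis m_assoc m_comm)
      thus "x \<otimes> y = \<zero>" using 1 x by simp
    qed
    have mem: "f \<otimes> x \<in> PIdl f" "f' \<otimes> x \<in> PIdl f'" if "x \<in> carrier R" for x
      using m_comm[OF f(1) that] m_comm[OF f' that] that unfolding cgenideal_def by blast+
    \<comment> \<open>Peirce decomposition: the ring is the product of its two corners. Its
      idempotents are pairs of idempotents, so the exponents add in both counts.\<close>
    have bij: "bij_betw (\<lambda>(x, y). x \<oplus> y) ((PIdl f) \<times> (PIdl f')) (carrier R)"
      by (rule bij_betw_byWitness[where f' = "\<lambda>x. (f \<otimes> x, f' \<otimes> x)"])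
         (use mem proj split I.Icarr J.Icarr in auto)
    have sq: "(x \<oplus> y) \<otimes> (x \<oplus> y) = x \<otimes> x \<oplus> y \<otimes> y" if xy: "x \<in> PIdl f" "y \<in> PIdl f'" for x y
    proof -
      have c: "x \<in> carrier R" "y \<in> carrier R" using xy I.Icarr J.Icarr by auto
      show ?thesis using prod[OF xy] c by (simp add: l_distr r_distr m_comm[of y x])
    qed
    have "bij_betw (\<lambda>(x, y). x \<oplus> y)
        ({x \<in> PIdl f. x \<otimes> x = x} \<times> {x \<in> PIdl f'. x \<otimes> x = x}) ?E"
    proof (rule bij_betw_byWitness[where f' = "\<lambda>x. (f \<otimes> x, f' \<otimes> x)"])
      have sq': "h \<otimes> x \<otimes> (h \<otimes> x) = h \<otimes> h \<otimes> (x \<otimes> x)" if "h \<in> carrier R" "x \<in> carrier R" for h x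
        using that by (simp add: m_ac)
      have "f \<otimes> x \<otimes> (f \<otimes> x) = f \<otimes> x \<and> f' \<otimes> x \<otimes> (f' \<otimes> x) = f' \<otimes> x" if "x \<in> ?E" for x
      proof -
        have "f \<otimes> x \<otimes> (f \<otimes> x) = f \<otimes> f \<otimes> (x \<otimes> x)" "f' \<otimes> x \<otimes> (f' \<otimes> x) = f' \<otimes> f' \<otimes> (x \<otimes> x)"
          using that f f' by (simp_all only: sq' mem_Collect_eq)
        thus ?thesis using that f f'f' by simp
      qed
      thus "(\<lambda>x. (f \<otimes> x, f' \<otimes> x)) ` ?E \<subseteq> {x \<in> PIdl f. x \<otimes> x = x} \<times> {x \<in> PIdl f'. x \<otimes> x = x}"
        using mem by auto
    qed (use proj split sq I.Icarr J.Icarr in auto)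
    hence "card ?E = 2 ^ (r + r')"
      using bij_betw_same_card r r' by (fastforce simp: card_cartesian_product power_add)
    moreover have "card (carrier R) = q ^ (r + r')"
      using bij_betw_same_card[OF bij] r r' by (simp add: card_cartesian_product power_add)
    ultimately show ?thesis by blast
  qed
qed

text \<open>The power identity bounds every field factor by \<open>q\<close> elements from above,
  the condition on ideals from below. So \<open>r\<close> counts the factors, and an idempotent is a
  choice of 0 or 1 in each.\<close>

lemma card_idempotents_of_fixed_power:
  fixes R :: "('a, 'b) ring_scheme" and q :: nat
  assumes "cring R" "finite (carrier R)" "q \<ge> 2"
    and "\<And>x. x \<in> carrier R \<Longrightarrow> x [^]\<^bsub>R\<^esub> q = x"
    and "\<And>e. e \<in> carrier R \<Longrightarrow> e \<otimes>\<^bsub>R\<^esub> e = e \<Longrightarrow> e \<noteq> \<zero>\<^bsub>R\<^esub> \<Longrightarrow> q \<le> card (PIdl\<^bsub>R\<^esub> e)"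
  shows "\<exists>r. card (carrier R) = q ^ r \<and> card {e \<in> carrier R. e \<otimes>\<^bsub>R\<^esub> e = e} = 2 ^ r"
  using assms(1,2,4,5)
proof (induction "card (carrier R)" arbitrary: R rule: less_induct)
  case (less R)
  interpret cring R by fact
  show ?case
    by (rule card_idempotents_of_fixed_power_step[OF less.hyps]) (use less.prems assms(3) in auto)
qed

subsection \<open>Polynomials and dilations in the group algebra\<close>

text \<open>Regrouping by the values of \<open>h\<close>: this passes between sums over exponents
  and sums over residues.\<close>

lemma sum_fibres:
  fixes f G :: "_ \<Rightarrow> 'b::comm_semiring_0"
  assumes "finite A" "finite I" "h ` A \<subseteq> I"
  shows "(\<Sum>i\<in>I. (\<Sum>a\<in>A. if h a = i then f a else 0) * G i) = (\<Sum>a\<in>A. f a * G (h a))"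
proof -
  have "(\<Sum>i\<in>I. (\<Sum>a\<in>A. if h a = i then f a else 0) * G i) =
      (\<Sum>a\<in>A. \<Sum>i\<in>I. if h a = i then f a * G i else 0)"
    unfolding sum_distrib_right by (subst sum.swap) (intro sum.cong refl, auto)
  also have "\<dots> = (\<Sum>a\<in>A. f a * G (h a))"
    using assms by (intro sum.cong) auto
  finally show ?thesis .
qed

text \<open>The indicator is separated from the entries to match the shape of
  \<open>sum_fibres\<close>.\<close>

lemma cyclic_conv_altdef:
  assumes "k < m"
  shows "cyclic_conv m u v $ k =
    (\<Sum>i<m. u $ i * (\<Sum>j<m. v $ j * (if (i + j) mod m = k then 1 else 0)))"
  unfolding cyclic_conv_index[OF assms] sum_distrib_left by (intro sum.cong refl) simp

text \<open>The image of a polynomial in \<open>F[X]/(X\<^sup>m - 1)\<close>, identified with \<open>F[\<int>\<^sub>m]\<close>.\<close>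

definition wrap :: "nat \<Rightarrow> 'a::comm_ring_1 poly \<Rightarrow> 'a vec" where
  "wrap m f = vec m (\<lambda>k. \<Sum>i\<le>degree f. if i mod m = k then coeff f i else 0)"

text \<open>The linear extension of \<open>i \<mapsto> a i\<close> from \<open>\<int>\<^sub>m\<close> to \<open>F[\<int>\<^sub>m]\<close>. For \<open>a = m - 1\<close> it is the
  involution \<open>i \<mapsto> -i\<close>, for \<open>a\<close> a power of \<open>|F|\<close> it is the \<open>a\<close>-th power map.\<close>

definition dilate :: "nat \<Rightarrow> nat \<Rightarrow> 'a::comm_ring_1 vec \<Rightarrow> 'a vec" where
  "dilate m a x = vec m (\<lambda>k. \<Sum>i<m. if a * i mod m = k then x $ i else 0)"

lemma dim_wrap [simp]: "dim_vec (wrap m f) = m"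
  by (simp add: wrap_def)

lemma wrap_carrier [simp]: "wrap m f \<in> carrier_vec m"
  by (rule carrier_vecI) simp

lemma dim_dilate [simp]: "dim_vec (dilate m a x) = m"
  by (simp add: dilate_def)

lemma dilate_carrier [simp]: "dilate m a x \<in> carrier_vec m"
  by (rule carrier_vecI) simp

lemma dim_cyclic_conv [simp]: "dim_vec (cyclic_conv m u v) = m"
  by (simp add: cyclic_conv_def)

lemma wrap_index:
  assumes "k < m" "degree f \<le> N"
  shows "wrap m f $ k = (\<Sum>i\<le>N. if i mod m = k then coeff f i else 0)"
  using assms unfolding wrap_def by (auto intro!: sum.mono_neutral_left intro: le_degree split: if_splits)

lemma dilate_index:
  "k < m \<Longrightarrow> dilate m a x $ k = (\<Sum>i<m. if a * i mod m = k then x $ i else 0)"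
  by (simp add: dilate_def)

lemma wrap_add: "wrap m (f + g) = wrap m f + wrap m g"
proof (rule eq_vecI)
  fix k assume "k < dim_vec (wrap m f + wrap m g)"
  hence k: "k < m" by simp
  let ?N = "max (degree f) (degree g)"
  show "wrap m (f + g) $ k = (wrap m f + wrap m g) $ k"
    using k by (subst index_add_vec(1), simp)
      (auto simp: wrap_index[of k m _ ?N] degree_add_le_max sum.distrib[symmetric] intro!: sum.cong)
qed simp

lemma wrap_0 [simp]: "wrap m 0 = 0\<^sub>v m"
  by (rule eq_vecI) (simp_all add: wrap_def cong: if_cong)

lemma wrap_sum_index:
  assumes "k < m"
  shows "wrap m (\<Sum>a\<in>A. f a) $ k = (\<Sum>a\<in>A. wrap m (f a) $ k)"
  using assms by (induction A rule: infinite_finite_induct) (simp_all add: wrap_add)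

lemma wrap_monom_index:
  assumes "k < m"
  shows "wrap m (monom c i) $ k = (if i mod m = k then c else 0)"
proof -
  have "wrap m (monom c i) $ k = (\<Sum>j\<le>i. if j mod m = k then coeff (monom c i) j else 0)"
    by (rule wrap_index[OF assms degree_monom_le])
  also have "\<dots> = (\<Sum>j\<le>i. if j = i then (if i mod m = k then c else 0) else 0)"
    by (intro sum.cong) auto
  finally show ?thesis by simp
qed

text \<open>The residue of \<open>a + b\<close> depends only on those of \<open>a\<close> and
  \<open>b\<close>, so both sums can be grouped by residues. Polynomial identities thereby pass to
  the group algebra.\<close>

lemma wrap_mult:
  assumes "m > 0"
  shows "wrap m (f * g) = cyclic_conv m (wrap m f) (wrap m g)"
proof (rule eq_vecI)
  fix k assume "k < dim_vec (cyclic_conv m (wrap m f) (wrap m g))"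
  hence k: "k < m" by simp
  have "f * g = (\<Sum>a\<le>degree f. monom (coeff f a) a) * (\<Sum>b\<le>degree g. monom (coeff g b) b)"
    by (simp only: poly_as_sum_of_monoms)
  also have "\<dots> = (\<Sum>a\<le>degree f. \<Sum>b\<le>degree g. monom (coeff f a * coeff g b) (a + b))"
    by (simp add: sum_product mult_monom)
  finally have "wrap m (f * g) $ k =
      (\<Sum>a\<le>degree f. coeff f a * (\<Sum>b\<le>degree g. coeff g b * (if (a + b) mod m = k then 1 else 0)))"
    using k by (simp add: wrap_sum_index wrap_monom_index sum_distrib_left if_distrib cong: if_cong)
  also have "\<dots> = (\<Sum>a\<le>degree f. coeff f a *
      (\<Sum>b\<le>degree g. coeff g b * (if (a mod m + b mod m) mod m = k then 1 else 0)))"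
    by (simp only: mod_add_eq)
  also have "\<dots> = (\<Sum>i<m. (\<Sum>a\<le>degree f. if a mod m = i then coeff f a else 0) *
      (\<Sum>b\<le>degree g. coeff g b * (if (i + b mod m) mod m = k then 1 else 0)))"
    using assms by (subst sum_fibres) auto
  also have "\<dots> = (\<Sum>i<m. (\<Sum>a\<le>degree f. if a mod m = i then coeff f a else 0) *
      (\<Sum>j<m. (\<Sum>b\<le>degree g. if b mod m = j then coeff g b else 0) *
         (if (i + j) mod m = k then 1 else 0)))"
    using assms by (subst sum_fibres) auto
  also have "\<dots> = cyclic_conv m (wrap m f) (wrap m g) $ k"
    unfolding cyclic_conv_altdef[OF k] by (intro sum.cong arg_cong2[where f = "(*)"]) (auto simp: wrap_def)
  finally show "wrap m (f * g) $ k = cyclic_conv m (wrap m f) (wrap m g) $ k" .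
qed simp

lemma wrap_monom_0: "m > 0 \<Longrightarrow> wrap m (monom c 0) = c \<cdot>\<^sub>v unit_vec m 0"
  by (rule eq_vecI) (auto simp: wrap_monom_index)

lemma wrap_1: "m > 0 \<Longrightarrow> wrap m 1 = unit_vec m 0"
  using wrap_monom_0[of m 1] by (simp add: monom_0 one_pCons)

lemma wrap_sum_monom:
  assumes "x \<in> carrier_vec m"
  shows "wrap m (\<Sum>i<m. monom (x $ i) i) = x"
  using assms by (intro eq_vecI) (auto simp: wrap_sum_index wrap_monom_index)

text \<open>Dilation is the substitution of \<open>X^a\<close> for \<open>X\<close>, which will make
  it a ring homomorphism.\<close>

lemma dilate_wrap:
  assumes "m > 0"
  shows "dilate m a (wrap m f) = wrap m (pcompose f (monom 1 a))"
proof (rule eq_vecI)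
  fix k assume "k < dim_vec (wrap m (pcompose f (monom 1 a)))"
  hence k: "k < m" by simp
  have "pcompose (monom c i) q = smult c (q ^ i)" for c :: 'a and i q
    by (induction i) (simp_all add: monom_0 monom_Suc pcompose_pCons)
  hence "pcompose (\<Sum>i\<le>degree f. monom (coeff f i) i) (monom 1 a) =
      (\<Sum>i\<le>degree f. monom (coeff f i) (a * i))"
    by (simp add: pcompose_sum monom_power smult_monom)
  hence "wrap m (pcompose f (monom 1 a)) $ k =
      (\<Sum>i\<le>degree f. coeff f i * (if a * (i mod m) mod m = k then 1 else 0))"
    using k by (simp add: poly_as_sum_of_monoms wrap_sum_index wrap_monom_index mod_mult_right_eq
        if_distrib cong: if_cong)
  also have "\<dots> = (\<Sum>j<m. (\<Sum>i\<le>degree f. if i mod m = j then coeff f i else 0) *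
      (if a * j mod m = k then 1 else 0))"
    using assms by (subst sum_fibres) auto
  also have "\<dots> = dilate m a (wrap m f) $ k"
    unfolding dilate_index[OF k] by (intro sum.cong) (auto simp: wrap_def)
  finally show "dilate m a (wrap m f) $ k = wrap m (pcompose f (monom 1 a)) $ k" by simp
qed simp

lemma dilate_dilate:
  assumes "m > 0" "x \<in> carrier_vec m"
  shows "dilate m a (dilate m b x) = dilate m (a * b) x"
proof (rule eq_vecI)
  fix k assume "k < dim_vec (dilate m (a * b) x)"
  hence k: "k < m" by simp
  have "dilate m a (dilate m b x) $ k =
      (\<Sum>j<m. (\<Sum>i<m. if b * i mod m = j then x $ i else 0) * (if a * j mod m = k then 1 else 0))"
    unfolding dilate_index[OF k] by (intro sum.cong) (auto simp: dilate_index)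
  also have "\<dots> = (\<Sum>i<m. x $ i * (if a * (b * i mod m) mod m = k then 1 else 0))"
    using assms by (subst sum_fibres) auto
  also have "\<dots> = dilate m (a * b) x $ k"
    unfolding dilate_index[OF k] by (intro sum.cong) (auto simp: mod_mult_right_eq mult.assoc)
  finally show "dilate m a (dilate m b x) $ k = dilate m (a * b) x $ k" .
qed simp

lemma dilate_cong_1:
  assumes "[a = 1] (mod m)" "x \<in> carrier_vec m"
  shows "dilate m a x = x"
proof (rule eq_vecI)
  fix k assume "k < dim_vec x"
  hence k: "k < m" using assms by simp
  have "a * i mod m = i" if "i < m" for i
    using cong_scalar_right[OF assms(1), of i] that by (simp add: cong_def)
  hence "dilate m a x $ k = (\<Sum>i<m. if i = k then x $ i else 0)"
    unfolding dilate_index[OF k] by (intro sum.cong) auto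
  thus "dilate m a x $ k = x $ k" using k by simp
qed (use assms in simp)

text \<open>The dilation sends \<open>l\<close> to \<open>-l\<close>, so exactly the products with
  \<open>j = l\<close> land at index 0. This expresses the bilinear form through multiplication and
  turns duals into annihilators.\<close>

lemma cyclic_conv_dilate_index_0:
  assumes "u \<in> carrier_vec m" "v \<in> carrier_vec m" "m > 0"
  shows "cyclic_conv m (dilate m (m - 1) u) v $ 0 = u \<bullet> v"
proof -
  have eq: "((m - 1) * l mod m + j) mod m = 0 \<longleftrightarrow> j = l" if "l < m" "j < m" for l j
  proof -
    have "(m - 1) * l + l = m * l" using assms(3) by (cases m) auto
    have "((m - 1) * l mod m + j) mod m = 0 \<longleftrightarrow> [(m - 1) * l + j = (m - 1) * l + l] (mod m)"
      using \<open>(m - 1) * l + l = m * l\<close> by (simp add: cong_def mod_add_left_eq)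
    also have "\<dots> \<longleftrightarrow> [j = l] (mod m)" by (rule cong_add_lcancel_nat)
    also have "\<dots> \<longleftrightarrow> j = l" using that by (auto simp: cong_def)
    finally show ?thesis .
  qed
  have "cyclic_conv m (dilate m (m - 1) u) v $ 0 =
      (\<Sum>i<m. (\<Sum>l<m. if (m - 1) * l mod m = i then u $ l else 0) *
        (\<Sum>j<m. v $ j * (if (i + j) mod m = 0 then 1 else 0)))"
    unfolding cyclic_conv_altdef[OF assms(3)] by (intro sum.cong) (auto simp: dilate_index)
  also have "\<dots> = (\<Sum>l<m. u $ l * (\<Sum>j<m. v $ j * (if ((m - 1) * l mod m + j) mod m = 0 then 1 else 0)))"
    using assms by (subst sum_fibres) auto
  also have "\<dots> = (\<Sum>l<m. u $ l * (\<Sum>j<m. if j = l then v $ j else 0))"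
    using eq by (intro sum.cong arg_cong2[where f = "(*)"] refl) auto
  also have "\<dots> = u \<bullet> v"
    using assms by (simp add: scalar_prod_def lessThan_atLeast0)
  finally show ?thesis .
qed

section \<open>Characteristic and Frobenius of a finite field\<close>

lemma CHAR_finite_field:
  assumes "prime p" and "card (UNIV :: 'a::{field,finite} set) = p ^ \<nu>"
  shows "CHAR('a) = p"
proof -
  have pr: "prime CHAR('a)"
    using prime_CHAR_semidom[where ?'a = 'a] finite_imp_CHAR_pos[where ?'a = 'a] by simp
  moreover have "CHAR('a) dvd p ^ \<nu>"
    using CHAR_dvd_CARD[where ?'a = 'a] assms by simp
  ultimately show ?thesis
    using assms(1) prime_dvd_power primes_dvd_imp_eq by blast
qed

lemma power_card_field_eq_same:
  fixes x :: "'a::{field,finite}"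
  shows "x ^ (card (UNIV :: 'a set) ^ t) = x"
proof -
  have *: "x ^ card (UNIV :: 'a set) = x" for x :: 'a
  proof (cases "x = 0")
    case False
    \<comment> \<open>Multiplication by \<open>x\<close> permutes the nonzero elements, whose
      product can then be cancelled.\<close>
    have "(\<Prod>y\<in>UNIV - {0}. x * y) = \<Prod>(UNIV - {0 :: 'a})"
      by (rule prod.reindex_bij_witness[of _ "\<lambda>y. y / x" "\<lambda>y. x * y"]) (use False in auto)
    hence "x ^ card (UNIV - {0 :: 'a}) = 1"
      by (simp add: prod.distrib)
    moreover have "card (UNIV :: 'a set) = Suc (card (UNIV - {0 :: 'a}))"
      by (rule card.remove) simp_all
    ultimately show ?thesis by (metis power_Suc mult_1_right)
  qed (simp add: card_gt_0_iff)
  show ?thesis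
    by (induction t) (simp_all add: * power_mult)
qed

subsection \<open>Complementary dual codes and symmetric idempotents\<close>

lemma cyclic_group_algebra_simps:
  "carrier (cyclic_group_algebra F m) = carrier_vec m"
  "x \<otimes>\<^bsub>cyclic_group_algebra F m\<^esub> y = cyclic_conv m x y"
  "\<one>\<^bsub>cyclic_group_algebra F m\<^esub> = unit_vec m 0"
  "\<zero>\<^bsub>cyclic_group_algebra F m\<^esub> = 0\<^sub>v m"
  "x \<oplus>\<^bsub>cyclic_group_algebra F m\<^esub> y = x + y"
  by (simp_all add: cyclic_group_algebra_def)

lemma (in cring) subcring_fixed_points:
  assumes "\<sigma> \<in> ring_hom R R"
  shows "subcring {x \<in> carrier R. \<sigma> x = x} R"
proof (rule subcringI'[OF subringI])
  fix h assume "h \<in> {x \<in> carrier R. \<sigma> x = x}"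
  hence h: "h \<in> carrier R" "\<sigma> h = h" by auto
  interpret \<sigma>: ring_hom_ring R R \<sigma>
    by (rule ring_hom_ringI2[OF ring_axioms ring_axioms assms])
  show "\<ominus> h \<in> {x \<in> carrier R. \<sigma> x = x}" using h by simp
qed (use assms in \<open>auto simp: ring_hom_mult ring_hom_add ring_hom_one\<close>)

lemma finite_carrier_vec: "finite (carrier_vec m :: 'a::finite vec set)"
proof (rule finite_subset)
  show "carrier_vec m \<subseteq> vec m ` ({..<m} \<rightarrow>\<^sub>E (UNIV :: 'a set))"
  proof
    fix v :: "'a vec" assume "v \<in> carrier_vec m"
    hence "v = vec m (restrict (($) v) {..<m})" by auto
    thus "v \<in> vec m ` ({..<m} \<rightarrow>\<^sub>E UNIV)" by (intro image_eqI[of v _ "restrict (($) v) {..<m}"]) auto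
  qed
qed (intro finite_imageI finite_PiE; simp)

context
  fixes m :: nat
  assumes m: "m > 0"
begin

abbreviation (input) "\<A> \<equiv> cyclic_group_algebra TYPE('a::field) m"

interpretation A: cring \<A>
  by (rule cring_cyclic_group_algebra[OF m])

lemma wrap_power: "wrap m (f ^ i) = wrap m f [^]\<^bsub>\<A>\<^esub> i"
  by (induction i)
     (simp_all add: wrap_1 wrap_mult m cyclic_group_algebra_simps power_Suc2 cyclic_conv_commute del: power_Suc)

lemma dilate_ring_hom: "dilate m a \<in> ring_hom \<A> \<A>"
proof (rule ring_hom_memI; unfold cyclic_group_algebra_simps)
  fix x y :: "'a vec" assume "x \<in> carrier_vec m" "y \<in> carrier_vec m"
  then obtain f g where [simp]: "x = wrap m f" "y = wrap m g"
    using wrap_sum_monom by metis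
  show "dilate m a (cyclic_conv m x y) = cyclic_conv m (dilate m a x) (dilate m a y)"
    by (simp add: dilate_wrap pcompose_mult m flip: wrap_mult)
  show "dilate m a (x + y) = dilate m a x + dilate m a y"
    by (simp add: dilate_wrap pcompose_add m flip: wrap_add)
next
  show "dilate m a (unit_vec m 0) = (unit_vec m 0 :: 'a vec)"
    by (simp add: dilate_wrap pcompose_1 m flip: wrap_1)
qed simp_all

text \<open>Division with remainder: a nonzero polynomial of least degree among those that wrap into
  \<open>C\<close> divides all of them, since the remainder wraps into \<open>C\<close> too.\<close>

lemma cyclic_code_principal:
  fixes C :: "'a::field vec set"
  assumes "cyclic_code m C"
  obtains g where "g \<in> carrier \<A>" "C = PIdl\<^bsub>\<A>\<^esub> g"
proof -
  interpret C: ideal C \<A> using assms by (simp add: cyclic_code_def)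
  \<comment> \<open>\<open>X^m - 1\<close> is a nonzero polynomial that wraps into every code, even
    the zero code, so a least degree exists.\<close>
  have "wrap m (monom 1 m + monom (-1) 0 :: 'a poly) = 0\<^sub>v m"
    by (rule eq_vecI) (auto simp: wrap_add wrap_monom_index)
  moreover have "degree (monom 1 m + monom (-1) 0 :: 'a poly) = m"
    using m by (subst degree_add_eq_left) (auto simp: degree_monom_eq)
  ultimately have "\<exists>f. f \<noteq> 0 \<and> wrap m f \<in> C"
    using m C.zero_closed by (metis cyclic_group_algebra_simps(4) degree_0 less_irrefl)
  then obtain f where f: "f \<noteq> 0" "wrap m f \<in> C"
    and min: "\<And>h. h \<noteq> 0 \<Longrightarrow> wrap m h \<in> C \<Longrightarrow> degree f \<le> degree h"
    using ex_has_least_nat[of "\<lambda>f. f \<noteq> 0 \<and> wrap m f \<in> C" _ degree] by blast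
  have "C = PIdl\<^bsub>\<A>\<^esub> (wrap m f)"
  proof
    show "C \<subseteq> PIdl\<^bsub>\<A>\<^esub> (wrap m f)"
    proof
      fix c assume c: "c \<in> C"
      then obtain h where h: "c = wrap m h"
        using C.Icarr wrap_sum_monom by (metis cyclic_group_algebra_simps(1))
      have "h mod f = h + (- (h div f)) * f"
        by (simp add: minus_div_mult_eq_mod)
      hence "wrap m (h mod f) = c \<oplus>\<^bsub>\<A>\<^esub> wrap m (- (h div f)) \<otimes>\<^bsub>\<A>\<^esub> wrap m f"
        by (simp only: wrap_add wrap_mult[OF m] h cyclic_group_algebra_simps)
      also have "\<dots> \<in> C"
        using c f by (intro C.a_closed C.I_l_closed) (auto simp: cyclic_group_algebra_simps)
      finally have "h mod f = 0"
        using min[of "h mod f"] degree_mod_less'[of f h] f by fastforce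
      hence "h = (h div f) * f" by (metis add.right_neutral div_mult_mod_eq)
      hence "c = wrap m (h div f) \<otimes>\<^bsub>\<A>\<^esub> wrap m f"
        unfolding h cyclic_group_algebra_simps wrap_mult[OF m, symmetric] by (rule arg_cong)
      thus "c \<in> PIdl\<^bsub>\<A>\<^esub> (wrap m f)"
        unfolding cgenideal_def using wrap_carrier cyclic_group_algebra_simps(1) by blast
    qed
    show "PIdl\<^bsub>\<A>\<^esub> (wrap m f) \<subseteq> C"
      by (rule A.cgenideal_minimal[OF C.ideal_axioms f(2)])
  qed
  thus thesis by (intro that[of "wrap m f"]) (auto simp: cyclic_group_algebra_simps)
qed

lemma dilate_involution:
  assumes "x \<in> carrier_vec m"
  shows "dilate m (m - 1) (dilate m (m - 1) x) = x"
proof -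
  obtain k where k: "m = Suc k" using m gr0_conv_Suc by blast
  \<comment> \<open>Both sides are multiples of \<open>k + 1\<close>; cancelling \<open>k\<close>
    shows that \<open>m - 1\<close> squares to 1 modulo \<open>m\<close>.\<close>
  have "[k * k + k = 1 + k] (mod Suc k)"
    unfolding cong_def
    by (metis add.commute mod_mult_self2_is_0 mod_self mult_Suc_right plus_1_eq_Suc)
  hence "[k * k = 1] (mod Suc k)"
    by (simp only: cong_add_rcancel_nat)
  thus ?thesis using k m assms by (simp add: dilate_dilate dilate_cong_1)
qed

text \<open>Orthogonality of \<open>c\<close> and \<open>v\<close> controls only the coefficient at
  0 of the product of dilated \<open>c\<close> with \<open>v\<close>. As \<open>C\<close> is an
  ideal, it also contains the shift of \<open>c\<close> by \<open>k\<close>, and this controls the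
  coefficient at \<open>k\<close>.\<close>

lemma euclidean_dual_cyclic_code:
  fixes C :: "'a::field vec set"
  assumes "cyclic_code m C"
  shows "euclidean_dual m C =
    {v \<in> carrier \<A>. \<forall>c\<in>C. dilate m (m - 1) c \<otimes>\<^bsub>\<A>\<^esub> v = \<zero>\<^bsub>\<A>\<^esub>}"
proof -
  interpret C: ideal C \<A> using assms by (simp add: cyclic_code_def)
  have car: "c \<in> carrier_vec m" if "c \<in> C" for c
    using C.Icarr[OF that] by (simp add: cyclic_group_algebra_simps)
  have "dilate m (m - 1) c \<otimes>\<^bsub>\<A>\<^esub> v = \<zero>\<^bsub>\<A>\<^esub>"
    if v: "v \<in> carrier_vec m" "\<forall>c\<in>C. c \<bullet> v = 0" and c: "c \<in> C" for v c
  proof (unfold cyclic_group_algebra_simps, rule eq_vecI)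
    fix k assume "k < dim_vec (0\<^sub>v m :: 'a vec)"
    hence k: "k < m" by simp
    let ?u = "unit_vec m k :: 'a vec" and ?w = "cyclic_conv m (dilate m (m - 1) c) v"
    have u: "?u \<in> carrier_vec m" by simp
    have "?u \<otimes>\<^bsub>\<A>\<^esub> c \<in> C"
      using c by (intro C.I_l_closed) (auto simp: cyclic_group_algebra_simps)
    hence "0 = cyclic_conv m ?u c \<bullet> v"
      using v by (simp add: cyclic_group_algebra_simps)
    also have "\<dots> = cyclic_conv m (dilate m (m - 1) (cyclic_conv m ?u c)) v $ 0"
      by (rule cyclic_conv_dilate_index_0[OF cyclic_conv_carrier v(1) m, symmetric])
    also have "dilate m (m - 1) (cyclic_conv m ?u c) =
        cyclic_conv m (dilate m (m - 1) ?u) (dilate m (m - 1) c)"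
      using ring_hom_mult[OF dilate_ring_hom, of ?u c "m - 1"] car[OF c] u
      by (simp add: cyclic_group_algebra_simps)
    also have "cyclic_conv m \<dots> v $ 0 = ?u \<bullet> ?w"
      unfolding cyclic_conv_assoc
      by (rule cyclic_conv_dilate_index_0[OF u cyclic_conv_carrier m])
    also have "\<dots> = ?w $ k" using k by (simp add: cyclic_conv_carrier)
    finally show "?w $ k = 0\<^sub>v m $ k" using k by simp
  qed simp
  moreover have "c \<bullet> v = 0"
    if "v \<in> carrier_vec m" "dilate m (m - 1) c \<otimes>\<^bsub>\<A>\<^esub> v = \<zero>\<^bsub>\<A>\<^esub>" "c \<in> C" for v c
    using cyclic_conv_dilate_index_0[OF car[OF that(3)] that(1) m] that(2) m
    by (simp add: cyclic_group_algebra_simps)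
  ultimately show ?thesis
    unfolding euclidean_dual_def by (auto simp: cyclic_group_algebra_simps(1))
qed

text \<open>A trivial intersection with the dual is the annihilator hypothesis of
  \<open>symmetric_idempotent_generator\<close>. Conversely, if \<open>e\<close> is symmetric, a
  \<open>v\<close> in both code and dual satisfies \<open>v = e v = 0\<close>.\<close>

lemma ecd_cyclic_codes_eq_image:
  "ecd_cyclic_codes TYPE('a::{field,finite}) m = (\<lambda>e. PIdl\<^bsub>\<A>\<^esub> e) `
     {e \<in> carrier \<A>. e \<otimes>\<^bsub>\<A>\<^esub> e = e \<and> dilate m (m - 1) e = e}"
proof (intro equalityI subsetI)
  note \<sigma> = dilate_ring_hom[where ?'a = 'a and a = "m - 1"]
  note \<sigma>_closed = ring_hom_closed[OF \<sigma>]
  have fin: "finite (carrier \<A> :: 'a vec set)"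
    by (simp add: cyclic_group_algebra_simps finite_carrier_vec)
  fix C :: "'a vec set" assume "C \<in> ecd_cyclic_codes TYPE('a) m"
  hence C: "cyclic_code m C" and ecd: "C \<inter> euclidean_dual m C = {\<zero>\<^bsub>\<A>\<^esub>}"
    by (auto simp: ecd_cyclic_codes_def euclidean_complementary_dual_def cyclic_group_algebra_simps(4))
  obtain g where g: "g \<in> carrier \<A>" "C = PIdl\<^bsub>\<A>\<^esub> g"
    using cyclic_code_principal[OF C] .
  have "\<exists>e\<in>carrier \<A>. e \<otimes>\<^bsub>\<A>\<^esub> e = e \<and> dilate m (m - 1) e = e \<and> PIdl\<^bsub>\<A>\<^esub> g = PIdl\<^bsub>\<A>\<^esub> e"
  proof (rule A.symmetric_idempotent_generator[OF fin \<sigma> _ g(1)])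
    fix y assume y: "y \<in> PIdl\<^bsub>\<A>\<^esub> g" "dilate m (m - 1) g \<otimes>\<^bsub>\<A>\<^esub> y = \<zero>\<^bsub>\<A>\<^esub>"
    have yc: "y \<in> carrier \<A>"
      using y(1) A.cgenideal_ideal[OF g(1)] by (rule ideal.Icarr[rotated])
    \<comment> \<open>Killing the dilated generator is enough to kill every dilated element of
      \<open>C\<close>, as dilation is multiplicative.\<close>
    have "dilate m (m - 1) (r \<otimes>\<^bsub>\<A>\<^esub> g) \<otimes>\<^bsub>\<A>\<^esub> y = \<zero>\<^bsub>\<A>\<^esub>" if r: "r \<in> carrier \<A>" for r
      unfolding ring_hom_mult[OF \<sigma> r g(1)]
        A.m_assoc[OF \<sigma>_closed[OF r] \<sigma>_closed[OF g(1)] yc] y(2)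
      by (rule A.r_null[OF \<sigma>_closed[OF r]])
    hence "y \<in> euclidean_dual m C"
      unfolding euclidean_dual_cyclic_code[OF C] using yc by (auto simp: g(2) cgenideal_def[of _ g])
    thus "y = \<zero>\<^bsub>\<A>\<^esub>" using ecd y(1) g(2) by blast
  qed (rule dilate_involution, simp add: cyclic_group_algebra_simps(1))
  thus "C \<in> (\<lambda>e. PIdl\<^bsub>\<A>\<^esub> e) ` {e \<in> carrier \<A>. e \<otimes>\<^bsub>\<A>\<^esub> e = e \<and> dilate m (m - 1) e = e}"
    using g(2) by blast
next
  fix C :: "'a vec set"
  assume "C \<in> (\<lambda>e. PIdl\<^bsub>\<A>\<^esub> e) ` {e \<in> carrier \<A>. e \<otimes>\<^bsub>\<A>\<^esub> e = e \<and> dilate m (m - 1) e = e}"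
  then obtain e where e: "e \<in> carrier \<A>" "e \<otimes>\<^bsub>\<A>\<^esub> e = e" "dilate m (m - 1) e = e"
    and C: "C = PIdl\<^bsub>\<A>\<^esub> e" by blast
  interpret C: ideal C \<A> unfolding C by (rule A.cgenideal_ideal[OF e(1)])
  have code: "cyclic_code m C" by (simp add: cyclic_code_def C.ideal_axioms)
  have "v = \<zero>\<^bsub>\<A>\<^esub>" if "v \<in> C" "v \<in> euclidean_dual m C" for v
  proof -
    have "e \<in> C" unfolding C by (rule A.cgenideal_self[OF e(1)])
    hence "dilate m (m - 1) e \<otimes>\<^bsub>\<A>\<^esub> v = \<zero>\<^bsub>\<A>\<^esub>"
      using that(2) unfolding euclidean_dual_cyclic_code[OF code] by blast
    thus ?thesis using A.idempotent_absorbs(1)[OF e(1,2), of v] that(1) e(3) C by simp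
  qed
  moreover have "\<zero>\<^bsub>\<A>\<^esub> \<in> euclidean_dual m C"
    unfolding euclidean_dual_cyclic_code[OF code]
    using C.Icarr by (auto intro!: A.r_null ring_hom_closed[OF dilate_ring_hom])
  ultimately have "C \<inter> euclidean_dual m C = {\<zero>\<^bsub>\<A>\<^esub>}"
    using C.zero_closed by auto
  thus "C \<in> ecd_cyclic_codes TYPE('a) m"
    using code by (simp add: ecd_cyclic_codes_def euclidean_complementary_dual_def cyclic_group_algebra_simps(4))
qed

text \<open>The \<open>Q\<close>-th power distributes over the monomials in characteristic
  \<open>p\<close> and fixes the coefficients, so it only multiplies the exponents by
  \<open>Q\<close>.\<close>

lemma power_eq_dilate:
  fixes x :: "'a::{field,finite} vec"
  assumes "prime p" "card (UNIV :: 'a set) = p ^ \<nu>" "x \<in> carrier_vec m" "Q = card (UNIV :: 'a set) ^ t"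
  shows "x [^]\<^bsub>\<A>\<^esub> Q = dilate m Q x"
proof -
  have char: "CHAR('a) = p" by (rule CHAR_finite_field[OF assms(1,2)])
  let ?f = "\<Sum>i<m. monom (x $ i) i"
  have "?f ^ Q = (\<Sum>i<m. monom (x $ i) i ^ Q)"
    by (rule freshmans_dream_sum'[where n = "\<nu> * t"]) (use assms char in \<open>auto simp: power_mult\<close>)
  also have "\<dots> = (\<Sum>i<m. monom (x $ i) (i * Q))"
    by (simp add: monom_power assms(4) power_card_field_eq_same)
  finally have "wrap m (?f ^ Q) = dilate m Q x"
    by (intro eq_vecI) (auto simp: wrap_sum_index wrap_monom_index dilate_index mult.commute)
  moreover have "wrap m (?f ^ Q) = x [^]\<^bsub>\<A>\<^esub> Q"
    by (simp only: wrap_power wrap_sum_monom[OF assms(3)])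
  ultimately show ?thesis by simp
qed

text \<open>Constants act as scalars, so a nonzero element has as many scalar multiples as the field
  has elements. This supplies the lower bound on ideals generated by idempotents.\<close>

lemma wrap_const_mult_inject:
  assumes "e \<in> carrier \<A>" "e \<noteq> \<zero>\<^bsub>\<A>\<^esub>"
    and "wrap m [:c:] \<otimes>\<^bsub>\<A>\<^esub> e = wrap m [:d:] \<otimes>\<^bsub>\<A>\<^esub> e"
  shows "c = d"
proof (rule ccontr)
  assume "c \<noteq> d"
  obtain f where f: "e = wrap m f"
    using assms(1) wrap_sum_monom by (metis cyclic_group_algebra_simps(1))
  have "wrap m (smult c f) = wrap m (smult d f)"
    using assms(3) by (simp add: f cyclic_group_algebra_simps m flip: wrap_mult)
  hence "wrap m (smult c f) + wrap m (smult (-d) f) = wrap m (smult d f) + wrap m (smult (-d) f)"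
    by simp
  hence "wrap m (smult (c - d) f) = 0\<^sub>v m"
    by (simp add: wrap_add[symmetric] smult_diff_left del: smult_minus_left flip: smult_add_left)
  hence "wrap m [:inverse (c - d):] \<otimes>\<^bsub>\<A>\<^esub> wrap m (smult (c - d) f) = \<zero>\<^bsub>\<A>\<^esub>"
    using A.r_null[of "wrap m [:inverse (c - d):]"] by (simp add: cyclic_group_algebra_simps)
  hence "wrap m f = 0\<^sub>v m"
    using \<open>c \<noteq> d\<close> by (simp add: cyclic_group_algebra_simps m flip: wrap_mult)
  thus False using assms(2) f by (simp add: cyclic_group_algebra_simps)
qed

text \<open>The count of idempotents is applied to the subring fixed by both dilations. Its exponent
  \<open>r\<close> stays unspecified here and is read off later from the cardinality of that
  subring.\<close>

lemma card_ecd_cyclic_codes: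
  assumes "prime p" "card (UNIV :: 'a::{field,finite} set) = p ^ \<nu>" "\<nu> > 0"
  shows "\<exists>r. card {x \<in> carrier_vec m :: 'a vec set. dilate m (p ^ \<nu>) x = x \<and> dilate m (m - 1) x = x}
      = (p ^ \<nu>) ^ r \<and> card (ecd_cyclic_codes TYPE('a) m) = 2 ^ r"
proof -
  let ?q = "p ^ \<nu>"
  define B :: "'a vec set" where
    "B = {x \<in> carrier_vec m. dilate m ?q x = x \<and> dilate m (m - 1) x = x}"
  have B_eq: "B = {x \<in> carrier \<A>. dilate m ?q x = x} \<inter> {x \<in> carrier \<A>. dilate m (m - 1) x = x}"
    by (auto simp: B_def cyclic_group_algebra_simps(1))
  have "subcring B \<A>"
    unfolding B_eq by (intro A.subcring_inter A.subcring_fixed_points dilate_ring_hom)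
  define S where "S = \<A>\<lparr>carrier := B\<rparr>"
  have BA: "B \<subseteq> carrier \<A>" by (auto simp: B_eq)
  have S: "cring S"
    using A.subcring_iff[OF BA] \<open>subcring B \<A>\<close> by (simp add: S_def)
  have pow_S: "x [^]\<^bsub>S\<^esub> i = x [^]\<^bsub>\<A>\<^esub> i" for x and i :: nat
    by (simp add: S_def nat_pow_def)
  have pow_q: "x [^]\<^bsub>\<A>\<^esub> ?q = x" if "x \<in> B" for x
    using power_eq_dilate[OF assms(1,2), of x ?q 1] that assms(2) by (auto simp: B_def)
  have fin: "finite (carrier \<A> :: 'a vec set)"
    by (simp add: cyclic_group_algebra_simps finite_carrier_vec)
  have q2: "?q \<ge> 2"
    using prime_ge_2_nat[OF assms(1)] assms(3) self_le_power[of p \<nu>] by linarith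
  have const: "wrap m [:c:] \<in> B" for c :: 'a
    by (simp add: B_def dilate_wrap m)
  have "\<exists>r. card (carrier S) = ?q ^ r \<and> card {e \<in> carrier S. e \<otimes>\<^bsub>S\<^esub> e = e} = 2 ^ r"
  proof (rule card_idempotents_of_fixed_power[OF S])
    show "finite (carrier S)" using finite_subset[OF BA fin] by (simp add: S_def)
    show "?q \<ge> 2" by (fact q2)
    show "x [^]\<^bsub>S\<^esub> ?q = x" if "x \<in> carrier S" for x
      using that pow_q unfolding pow_S by (simp add: S_def)
    fix e assume e: "e \<in> carrier S" "e \<noteq> \<zero>\<^bsub>S\<^esub>"
    hence "inj (\<lambda>c. wrap m [:c:] \<otimes>\<^bsub>\<A>\<^esub> e)"
      using BA wrap_const_mult_inject[of e] by (intro injI) (auto simp: S_def)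
    moreover have "range (\<lambda>c. wrap m [:c:] \<otimes>\<^bsub>\<A>\<^esub> e) \<subseteq> PIdl\<^bsub>S\<^esub> e"
      unfolding cgenideal_def S_def using const by auto
    moreover have "finite (PIdl\<^bsub>S\<^esub> e)"
      using finite_subset[OF BA fin] by (simp add: cgenideal_def S_def)
    ultimately show "?q \<le> card (PIdl\<^bsub>S\<^esub> e)"
      using card_inj_on_le[of _ UNIV] assms(2) by metis
  qed
  moreover have "{e \<in> carrier S. e \<otimes>\<^bsub>S\<^esub> e = e} =
      {e \<in> carrier \<A>. e \<otimes>\<^bsub>\<A>\<^esub> e = e \<and> dilate m (m - 1) e = e}" (is "?I = ?J")
  proof (intro equalityI subsetI)
    fix e assume e: "e \<in> ?J"
    \<comment> \<open>An idempotent equals all its positive powers, so it is automatically fixed by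
      the dilation by \<open>q\<close>, which is the \<open>q\<close>-th power map.\<close>
    have "e [^]\<^bsub>\<A>\<^esub> Suc i = e" for i
      using e by (induction i) auto
    moreover obtain i where "?q = Suc i" using q2 by (cases ?q) auto
    ultimately have "e [^]\<^bsub>\<A>\<^esub> ?q = e" by (simp only:)
    hence "dilate m ?q e = e"
      using e power_eq_dilate[OF assms(1,2), of e ?q 1] assms(2)
      by (simp add: cyclic_group_algebra_simps(1))
    thus "e \<in> ?I" using e by (simp add: S_def B_eq)
  qed (auto simp: S_def B_eq)
  moreover have "card ?J = card (ecd_cyclic_codes TYPE('a) m)"
    unfolding ecd_cyclic_codes_eq_image
    by (rule card_image[symmetric], rule inj_on_subset[OF A.inj_on_idempotent_cgenideal]) auto
  ultimately show ?thesis by (auto simp: S_def B_def)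
qed

end

subsection \<open>Signed cyclotomic cosets\<close>

text \<open>The orbit relation of the group generated by \<open>q\<close> and \<open>-1\<close> acting on \<open>\<int>\<^sub>n\<close>.\<close>

definition signed_coset_rel :: "nat \<Rightarrow> nat \<Rightarrow> (nat \<times> nat) set" where
  "signed_coset_rel n q = {(i, j). i < n \<and> j < n \<and>
     (\<exists>t. \<exists>\<epsilon>\<in>{1, -1}. [int j = \<epsilon> * int q ^ t * int i] (mod int n))}"

lemma signed_coset_rel_iff:
  "(i, j) \<in> signed_coset_rel n q \<longleftrightarrow> i < n \<and> j < n \<and>
     (\<exists>t. \<exists>\<epsilon>\<in>{1, -1}. [int j = \<epsilon> * int q ^ t * int i] (mod int n))"
  by (simp add: signed_coset_rel_def)

lemma equiv_signed_coset_rel: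
  assumes "n > 0" "coprime n q"
  shows "equiv {..<n} (signed_coset_rel n q)"
proof (rule equivI)
  show "refl_on {..<n} (signed_coset_rel n q)"
    by (rule refl_onI) (auto simp: signed_coset_rel_def intro!: exI[of _ 0])
  show "sym (signed_coset_rel n q)"
  proof (rule symI)
    fix i j assume "(i, j) \<in> signed_coset_rel n q"
    then obtain t \<epsilon> where lt: "i < n" "j < n" and \<epsilon>: "\<epsilon> \<in> {1, -1 :: int}"
      and c: "[int j = \<epsilon> * int q ^ t * int i] (mod int n)"
      unfolding signed_coset_rel_iff by blast
    \<comment> \<open>The relation uses nonnegative exponents only. By Euler's theorem
      \<open>q ^ ((T - 1) * t)\<close> is an inverse of \<open>q ^ t\<close> modulo
      \<open>n\<close>.\<close>
    define T where "T = totient n"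
    have "T > 0" using assms by (simp add: T_def)
    have "[int q ^ T = 1] (mod int n)"
      using euler_theorem[of q n] assms unfolding T_def
      by (metis cong_int_iff coprime_commute of_nat_1 of_nat_power)
    hence "[(int q ^ T) ^ t = 1] (mod int n)"
      using cong_pow by fastforce
    hence 1: "[int q ^ (T * t) * int i = int i] (mod int n)"
      using cong_scalar_right[of _ 1 _ "int i"] by (simp add: power_mult)
    have "[\<epsilon> * int q ^ ((T - 1) * t) * int j = \<epsilon> * int q ^ ((T - 1) * t) * (\<epsilon> * int q ^ t * int i)] (mod int n)"
      by (rule cong_scalar_left[OF c])
    also have "\<epsilon> * int q ^ ((T - 1) * t) * (\<epsilon> * int q ^ t * int i) = \<epsilon> * \<epsilon> * int q ^ ((T - 1) * t + t) * int i"
      by (simp add: power_add)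
    also have "\<epsilon> * \<epsilon> = 1" using \<epsilon> by auto
    also have "(T - 1) * t + t = T * t" using \<open>T > 0\<close> by (cases T) auto
    finally have "[\<epsilon> * int q ^ ((T - 1) * t) * int j = int q ^ (T * t) * int i] (mod int n)"
      by simp
    from cong_trans[OF this 1] have "[int i = \<epsilon> * int q ^ ((T - 1) * t) * int j] (mod int n)"
      by (rule cong_sym)
    thus "(j, i) \<in> signed_coset_rel n q"
      unfolding signed_coset_rel_iff using lt \<epsilon> by blast
  qed
  show "trans (signed_coset_rel n q)"
  proof (rule transI)
    fix i j l assume "(i, j) \<in> signed_coset_rel n q" "(j, l) \<in> signed_coset_rel n q"
    then obtain t s \<epsilon> \<delta> where lt: "i < n" "l < n" and \<epsilon>: "\<epsilon> \<in> {1, -1 :: int}" and \<delta>: "\<delta> \<in> {1, -1 :: int}"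
      and c: "[int j = \<epsilon> * int q ^ t * int i] (mod int n)" "[int l = \<delta> * int q ^ s * int j] (mod int n)"
      unfolding signed_coset_rel_iff by blast
    have "[int l = \<delta> * int q ^ s * (\<epsilon> * int q ^ t * int i)] (mod int n)"
      using c(2) cong_scalar_left[OF c(1)] by (rule cong_trans)
    also have "\<delta> * int q ^ s * (\<epsilon> * int q ^ t * int i) = (\<delta> * \<epsilon>) * int q ^ (s + t) * int i"
      by (simp add: power_add)
    finally have "[int l = (\<delta> * \<epsilon>) * int q ^ (s + t) * int i] (mod int n)" .
    moreover have "\<delta> * \<epsilon> \<in> {1, -1}" using \<epsilon> \<delta> by auto
    ultimately show "(i, l) \<in> signed_coset_rel n q"
      unfolding signed_coset_rel_iff using lt by blast
  qed
qed (auto simp: signed_coset_rel_def)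

text \<open>The new modulus is the additive order of \<open>i\<close> modulo
  \<open>n\<close>.\<close>

lemma cong_mult_gcd_cancel:
  fixes a b :: int and i n :: nat
  assumes "n > 0"
  shows "[a * int i = b * int i] (mod int n) \<longleftrightarrow> [a = b] (mod int (n div gcd i n))"
proof -
  define g where "g = gcd i n"
  have g: "g > 0" using assms by (simp add: g_def)
  obtain d u where du: "n = d * g" "i = u * g" "coprime u d"
    using gcd_coprime_exists[of i n] assms unfolding g_def by force
  have "[a * int i = b * int i] (mod int n) \<longleftrightarrow> int d * int g dvd (a - b) * int u * int g"
    by (simp add: cong_iff_dvd_diff du algebra_simps)
  also have "\<dots> \<longleftrightarrow> int d dvd (a - b) * int u" using g by simp
  also have "\<dots> \<longleftrightarrow> int d dvd a - b"
    using du(3) by (intro coprime_dvd_mult_left_iff) (simp add: coprime_commute)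
  also have "d = n div gcd i n" using du(1) g unfolding g_def by (metis nonzero_mult_div_cancel_right not_gr0)
  finally show ?thesis by (simp only: cong_iff_dvd_diff)
qed

text \<open>The orbit is the union of its parts \<open>P 1\<close> and \<open>P (-1)\<close> of the
  two signs, each of size \<open>ord d q\<close>. They coincide if \<open>-1\<close> is a power of
  \<open>q\<close> modulo \<open>d\<close> and are disjoint otherwise.\<close>

lemma card_signed_coset:
  assumes "n > 0" "coprime n q" "i < n"
  defines "d \<equiv> n div gcd i n"
  shows "card (signed_coset_rel n q `` {i}) = (if chi d q = 1 then ord d q else 2 * ord d q)"
proof -
  define P where "P \<epsilon> = {j. j < n \<and> (\<exists>t. [int j = \<epsilon> * int q ^ t * int i] (mod int n))}" for \<epsilon>
  define r where "r \<epsilon> t = nat ((\<epsilon> * int q ^ t * int i) mod int n)" for \<epsilon> t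
  have r: "r \<epsilon> t < n" "[int (r \<epsilon> t) = \<epsilon> * int q ^ t * int i] (mod int n)" for \<epsilon> t
    using assms(1) by (auto simp: r_def nat_less_iff cong_def)
  have uniq: "j = r \<epsilon> t" if "j < n" "[int j = \<epsilon> * int q ^ t * int i] (mod int n)" for j \<epsilon> t
    using that by (simp add: r_def cong_def)
  have r_eq_iff: "r \<epsilon> t = r \<delta> s \<longleftrightarrow> [\<epsilon> * int q ^ t = \<delta> * int q ^ s] (mod int d)" for \<epsilon> \<delta> t s
  proof -
    have "r \<epsilon> t = r \<delta> s \<longleftrightarrow> [\<epsilon> * int q ^ t * int i = \<delta> * int q ^ s * int i] (mod int n)"
      using r uniq by (metis cong_sym cong_trans)
    thus ?thesis unfolding d_def cong_mult_gcd_cancel[OF assms(1)] .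
  qed
  have "d * gcd i n = n" by (simp add: d_def)
  hence "d dvd n" by (metis dvd_triv_left)
  have cop: "coprime d q" by (rule coprime_divisors[OF \<open>d dvd n\<close> dvd_refl assms(2)])
  have ord: "ord d q > 0" using cop ord_eq_0[of d q] by simp
  have r_eq: "r \<epsilon> t = r \<epsilon> s \<longleftrightarrow> [t = s] (mod ord d q)" if "\<epsilon> \<in> {1, -1}" for \<epsilon> t s
  proof -
    have "r \<epsilon> t = r \<epsilon> s \<longleftrightarrow> [int q ^ t = int q ^ s] (mod int d)"
      using that unfolding r_eq_iff by (auto simp: cong_minus_minus_iff)
    also have "\<dots> \<longleftrightarrow> [q ^ t = q ^ s] (mod d)"
      by (simp flip: cong_int_iff)
    also have "\<dots> \<longleftrightarrow> [t = s] (mod ord d q)"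
      by (rule order_divides_expdiff[OF cop])
    finally show ?thesis .
  qed
  have P_image: "P \<epsilon> = r \<epsilon> ` {..<ord d q}" if "\<epsilon> \<in> {1, -1}" for \<epsilon>
  proof (intro equalityI subsetI)
    fix j assume "j \<in> P \<epsilon>"
    then obtain t where "j = r \<epsilon> t" using uniq by (auto simp: P_def)
    also have "\<dots> = r \<epsilon> (t mod ord d q)" unfolding r_eq[OF that] by (simp add: cong_def)
    finally show "j \<in> r \<epsilon> ` {..<ord d q}" using ord by auto
  qed (use r in \<open>force simp: P_def\<close>)
  have card_P: "card (P \<epsilon>) = ord d q" if "\<epsilon> \<in> {1, -1}" for \<epsilon>
    unfolding P_image[OF that]
    by (subst card_image) (auto intro!: inj_onI simp: r_eq[OF that] cong_def)
  have fin: "finite (P \<epsilon>)" for \<epsilon> by (simp add: P_def)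
  have coset: "signed_coset_rel n q `` {i} = P 1 \<union> P (-1)"
    using assms(3) by (auto simp: signed_coset_rel_def P_def)
  show ?thesis
  proof (cases "chi d q = 1")
    case True
    then obtain l where l: "d dvd q ^ l + 1" by (auto simp: chi_def split: if_splits)
    \<comment> \<open>As \<open>q ^ l\<close> is \<open>-1\<close> modulo \<open>d\<close>, a change
      of sign amounts to adding \<open>l\<close> to the exponent.\<close>
    have neg: "[\<epsilon> * int q ^ t = - \<epsilon> * int q ^ (t + l)] (mod int d)" for \<epsilon> t
    proof -
      have "int d dvd int (q ^ l + 1)" using l by (simp only: int_dvd_int_iff)
      hence "int d dvd \<epsilon> * int q ^ t * int (q ^ l + 1)" by (rule dvd_mult)
      thus ?thesis by (simp add: cong_iff_dvd_diff algebra_simps power_add)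
    qed
    have "P \<epsilon> \<subseteq> P (- \<epsilon>)" for \<epsilon>
    proof
      fix j assume "j \<in> P \<epsilon>"
      then obtain t where "j = r \<epsilon> t" using uniq by (auto simp: P_def)
      also have "\<dots> = r (- \<epsilon>) (t + l)" unfolding r_eq_iff by (rule neg)
      finally show "j \<in> P (- \<epsilon>)" unfolding P_def using r by blast
    qed
    from this[of 1] this[of "-1"] have "P (-1) = P 1" by auto
    thus ?thesis using True card_P[of 1] coset by simp
  next
    case False
    have "P 1 \<inter> P (-1) = {}"
    proof (rule ccontr)
      assume "P 1 \<inter> P (-1) \<noteq> {}"
      then obtain j t s where "j < n" "[int j = 1 * int q ^ t * int i] (mod int n)"
        "[int j = - 1 * int q ^ s * int i] (mod int n)"
        unfolding P_def by blast
      hence "r 1 t = r (-1) s" using uniq by metis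
      hence "[int q ^ t = - (int q ^ s)] (mod int d)" by (simp add: r_eq_iff)
      hence "int d dvd int (q ^ t + q ^ s)" by (simp add: cong_iff_dvd_diff)
      hence ts: "d dvd q ^ t + q ^ s" by (simp only: int_dvd_int_iff)
      define T where "T = ord d q"
      have T: "T > 0" "[q ^ T = 1] (mod d)" using ord ord_works[of q d] by (auto simp: T_def)
      have "[(q ^ T) ^ s = 1] (mod d)" using cong_pow[OF T(2), of s] by simp
      hence "[q ^ (T * s) = 1] (mod d)" by (simp add: power_mult)
      \<comment> \<open>Multiplying by \<open>q ^ ((T - 1) * s)\<close> turns \<open>q ^ s\<close>
        into a power congruent to 1. The extra \<open>T\<close> makes the exponent positive, as
        \<open>chi\<close> demands.\<close>
      define l where "l = t + (T - 1) * s + T"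
      have "d dvd q ^ ((T - 1) * s + T) * (q ^ t + q ^ s)" using ts by (rule dvd_mult)
      also have "\<dots> = q ^ l + q ^ ((T - 1) * s + s) * q ^ T"
        by (simp add: l_def algebra_simps power_add)
      also have "(T - 1) * s + s = T * s" using T(1) by (cases T) auto
      finally have "[q ^ l + q ^ (T * s) * q ^ T = 0] (mod d)" by (simp add: cong_0_iff)
      moreover have "[q ^ l + q ^ (T * s) * q ^ T = q ^ l + 1 * 1] (mod d)"
        using \<open>[q ^ (T * s) = 1] (mod d)\<close> T(2) by (intro cong_add cong_mult cong_refl)
      ultimately have "d dvd q ^ l + 1" by (metis cong_0_iff cong_sym cong_trans mult_1)
      moreover have "l > 0" using T by (simp add: l_def)
      ultimately have "\<exists>l>0. d dvd q ^ l + 1" by blast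
      thus False using False by (simp only: chi_def if_True simp_thms)
    qed
    thus ?thesis using False card_P coset fin by (simp add: card_Un_disjoint)
  qed
qed

text \<open>Each class \<open>X\<close> contributes \<open>card X\<close> terms equal to
  \<open>1 / card X\<close>, hence 1.\<close>

lemma sum_inverse_card_equiv_class:
  assumes "finite A" "equiv A r"
  shows "(\<Sum>x\<in>A. 1 / real (card (r `` {x}))) = real (card (A // r))"
proof -
  have fin: "finite X" "X \<noteq> {}" if "X \<in> A // r" for X
    using that assms finite_equiv_class in_quotient_imp_non_empty equiv_type by metis+
  have "(\<Sum>x\<in>A. 1 / real (card (r `` {x}))) = (\<Sum>x\<in>\<Union>(A // r). 1 / real (card (r `` {x})))"
    using Union_quotient[OF assms(2)] by simp
  also have "\<dots> = (\<Sum>X\<in>A // r. \<Sum>x\<in>X. 1 / real (card (r `` {x})))"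
    using fin quotient_disj[OF assms(2)] by (subst sum.Union_disjoint) (simp_all add: o_def, blast+)
  also have "\<dots> = (\<Sum>X\<in>A // r. \<Sum>x\<in>X. 1 / real (card X))"
  proof (intro sum.cong refl)
    fix X x assume "X \<in> A // r" "x \<in> X"
    hence "r `` {x} = X" by (metis assms(2) Image_singleton_iff equiv_class_eq_iff quotientE)
    thus "1 / real (card (r `` {x})) = 1 / real (card X)" by simp
  qed
  also have "\<dots> = (\<Sum>X\<in>A // r. 1)"
    using fin by (intro sum.cong) (auto simp: card_gt_0_iff)
  finally show ?thesis by simp
qed

text \<open>Exactly \<open>totient d\<close> residues modulo \<open>n\<close> have additive order
  \<open>d\<close>.\<close>

lemma sum_over_gcd_classes:
  fixes f :: "nat \<Rightarrow> real"
  assumes "n > 0"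
  shows "(\<Sum>i<n. f (n div gcd i n)) = (\<Sum>d | d dvd n. real (totient d) * f d)"
proof -
  have 1: "{..<n} = insert 0 {0<..<n}" "{0<..n} = insert n {0<..<n}" using assms by auto
  \<comment> \<open>Index 0 is exchanged for \<open>n\<close>, which has the same gcd with
    \<open>n\<close>, to reach the range used in \<open>card_gcd_eq_totient\<close>.\<close>
  have "(\<Sum>i<n. f (n div gcd i n)) = (\<Sum>i\<in>{0<..n}. f (n div gcd i n))"
    unfolding 1 by (subst (1 2) sum.insert) auto
  also have "\<dots> = (\<Sum>d | d dvd n. \<Sum>i | i \<in> {0<..n} \<and> n div gcd i n = d. f (n div gcd i n))"
    using assms by (intro sum.group[symmetric]) (auto simp: div_dvd_iff_mult)
  also have "\<dots> = (\<Sum>d | d dvd n. real (totient d) * f d)"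
  proof (intro sum.cong refl)
    fix d assume "d \<in> {d. d dvd n}"
    then obtain g where g: "n = g * d" by (metis dvdE mem_Collect_eq mult.commute)
    hence "g > 0" "d > 0" using assms by auto
    have "n div gcd i n = d \<longleftrightarrow> gcd i n = g" for i
    proof -
      obtain c where "n = gcd i n * c" by (rule dvdE[OF gcd_dvd2])
      thus ?thesis using g assms by (metis mult_cancel1 mult_cancel2 nonzero_mult_div_cancel_left mult_is_0 less_numeral_extra(3))
    qed
    hence "{i. i \<in> {0<..n} \<and> n div gcd i n = d} = {i \<in> {0<..n}. gcd i n = g}" by auto
    moreover have "card {i \<in> {0<..n}. gcd i n = g} = totient d"
      using card_gcd_eq_totient[OF assms, of g] g \<open>g > 0\<close> by simp
    moreover have "(\<Sum>i | i \<in> {0<..n} \<and> n div gcd i n = d. f (n div gcd i n)) =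
        (\<Sum>i | i \<in> {0<..n} \<and> n div gcd i n = d. f d)" by (intro sum.cong) auto
    ultimately show "(\<Sum>i | i \<in> {0<..n} \<and> n div gcd i n = d. f (n div gcd i n)) = real (totient d) * f d"
      by simp
  qed
  finally show ?thesis .
qed

text \<open>Every residue is weighted by the reciprocal of its orbit size; the factor one half comes
  from the orbits of double size.\<close>

lemma card_signed_cosets:
  assumes "n > 0" "coprime n q"
  shows "real (card ({..<n} // signed_coset_rel n q)) =
    (\<Sum>d | d dvd n. real (chi d q) * (real (totient d) / real (ord d q)))
    + 1 / 2 * (\<Sum>d | d dvd n. (1 - real (chi d q)) * (real (totient d) / real (ord d q)))"
proof -
  let ?f = "\<lambda>d. 1 / real (if chi d q = 1 then ord d q else 2 * ord d q)"
  have "real (card ({..<n} // signed_coset_rel n q)) = (\<Sum>i<n. ?f (n div gcd i n))"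
    unfolding sum_inverse_card_equiv_class[OF finite_lessThan equiv_signed_coset_rel[OF assms], symmetric]
    by (intro sum.cong refl) (simp add: card_signed_coset[OF assms])
  also have "\<dots> = (\<Sum>d | d dvd n. real (totient d) * ?f d)"
    by (rule sum_over_gcd_classes[OF assms(1)])
  also have "\<dots> = (\<Sum>d | d dvd n. real (chi d q) * (real (totient d) / real (ord d q)) +
      1 / 2 * ((1 - real (chi d q)) * (real (totient d) / real (ord d q))))"
    by (intro sum.cong refl) (auto simp: chi_def)
  finally show ?thesis by (simp add: sum.distrib sum_distrib_left)
qed

section \<open>Vectors supported on the multiples of \<open>P\<close>, and their orbits\<close>

context
  fixes n P m :: nat
  assumes n: "n > 0" and P: "P > 0" and m_def: "m = n * P"
begin

text \<open>Modulo \<open>n * P\<close>, the multiples of \<open>P\<close> form a copy of the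
  residues modulo \<open>n\<close>. There \<open>a\<close> acts as a permutation, although dilation
  by a power of \<open>p\<close> can fail to be injective on all indices.\<close>

lemma dilate_supported_index:
  assumes a: "coprime a n" and supp: "\<And>j. j < m \<Longrightarrow> \<not> P dvd j \<Longrightarrow> x $ j = 0" and i: "i < n"
  shows "dilate m a x $ (P * (a * i mod n)) = x $ (P * i)"
proof -
  have lt: "P * (a * i mod n) < m" "P * i < m" using n P i by (simp_all add: m_def mult.commute)
  have term_eq: "(if a * l mod m = P * (a * i mod n) then x $ l else 0) = (if l = P * i then x $ l else 0)"
    if l: "l < m" for l
  proof (cases "P dvd l")
    case True
    then obtain l' where l': "l = P * l'" by (elim dvdE)
    hence "l' < n" using l P by (simp add: m_def mult.commute)
    have "a * l mod m = P * (a * l' mod n)"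
      using mod_mult_mult1[of P "a * l'" n] by (simp add: l' m_def ac_simps)
    hence "a * l mod m = P * (a * i mod n) \<longleftrightarrow> [a * l' = a * i] (mod n)"
      using P by (simp add: cong_def)
    also have "\<dots> \<longleftrightarrow> l' = i"
      unfolding cong_mult_lcancel_nat[OF a] using \<open>l' < n\<close> i by (simp add: cong_def)
    finally show ?thesis using P l' by simp
  qed (use supp[OF l] in auto)
  have "dilate m a x $ (P * (a * i mod n)) = (\<Sum>l<m. if l = P * i then x $ l else 0)"
    unfolding dilate_index[OF lt(1)] by (intro sum.cong refl) (use term_eq in simp)
  thus ?thesis using lt(2) by simp
qed

lemma dilate_supported_index_0:
  assumes supp: "\<And>j. j < m \<Longrightarrow> \<not> P dvd j \<Longrightarrow> x $ j = 0" and j: "j < m" "\<not> P dvd j"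
  shows "dilate m a x $ j = 0"
  unfolding dilate_index[OF j(1)]
proof (intro sum.neutral ballI)
  fix l assume "l \<in> {..<m}"
  thus "(if a * l mod m = j then x $ l else 0) = 0"
    using supp[of l] j(2) by (cases "P dvd l") (auto simp: m_def dvd_mod_iff)
qed

lemma dilate_eq_self_iff:
  assumes a: "coprime a n" and supp: "\<And>j. j < m \<Longrightarrow> \<not> P dvd j \<Longrightarrow> x $ j = 0"
    and x: "x \<in> carrier_vec m"
  shows "dilate m a x = x \<longleftrightarrow> (\<forall>i<n. x $ (P * (a * i mod n)) = x $ (P * i))"
proof
  assume "dilate m a x = x"
  thus "\<forall>i<n. x $ (P * (a * i mod n)) = x $ (P * i)"
    using dilate_supported_index[OF a supp] by metis
next
  assume inv: "\<forall>i<n. x $ (P * (a * i mod n)) = x $ (P * i)"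
  show "dilate m a x = x"
  proof (rule eq_vecI)
    fix j assume "j < dim_vec x"
    hence j: "j < m" using x by simp
    show "dilate m a x $ j = x $ j"
    proof (cases "P dvd j")
      case True
      then obtain j' where j': "j = P * j'" by (elim dvdE)
      hence "j' < n" using j P by (simp add: m_def mult.commute)
      \<comment> \<open>The inverse of \<open>a\<close> modulo \<open>n\<close> exhibits
        \<open>j'\<close> as an image, so the formula for image positions covers every multiple of
        \<open>P\<close>.\<close>
      obtain b where b: "[a * b = 1] (mod n)"
        using cong_solve_coprime_nat[OF a] by auto
      define i where "i = b * j' mod n"
      have i: "i < n" using n by (simp add: i_def)
      have "[a * i = a * b * j'] (mod n)"
        by (simp add: i_def cong_def mod_mult_right_eq mult.assoc)
      also have "[a * b * j' = 1 * j'] (mod n)" by (rule cong_scalar_right[OF b])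
      finally have "a * i mod n = j'" using \<open>j' < n\<close> by (simp add: cong_def)
      thus ?thesis
        using dilate_supported_index[OF a supp i] inv i j' by metis
    qed (use dilate_supported_index_0[OF supp j] supp[OF j] in simp)
  qed (use x in simp)
qed

text \<open>A fixed vector is also fixed by the dilation by \<open>q ^ t\<close>. That dilation
  moves all indices to multiples of \<open>P\<close>, because \<open>P\<close> divides both
  \<open>q ^ t\<close> and \<open>m\<close>.\<close>

lemma dilate_fixed_supported:
  assumes x: "x \<in> carrier_vec m" and fixed: "dilate m q x = x" and "P dvd q ^ t"
    and j: "j < m" "\<not> P dvd j"
  shows "x $ j = 0"
proof -
  have m: "m > 0" using j by simp
  have "dilate m (q ^ s) x = x" for s
    by (induction s) (use x fixed m in \<open>simp_all add: dilate_cong_1 flip: dilate_dilate\<close>)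
  hence "x $ j = dilate m (q ^ t) x $ j" by simp
  also have "\<dots> = 0"
    unfolding dilate_index[OF j(1)]
  proof (intro sum.neutral ballI)
    fix l
    have "P dvd q ^ t * l mod m" using assms(3) by (simp add: m_def dvd_mod_iff)
    thus "(if q ^ t * l mod m = j then x $ l else 0) = 0" using j(2) by auto
  qed
  finally show ?thesis .
qed

lemma card_dilate_fixed:
  fixes q t :: nat
  assumes q: "coprime n q" "P dvd q ^ t"
  shows "card {x \<in> carrier_vec m :: 'a::{field,finite} vec set. dilate m q x = x \<and> dilate m (m - 1) x = x}
    = card (UNIV :: 'a set) ^ card ({..<n} // signed_coset_rel n q)"
proof -
  define B where "B = {x \<in> carrier_vec m :: 'a vec set. dilate m q x = x \<and> dilate m (m - 1) x = x}"
  let ?r = "signed_coset_rel n q" and ?Q = "{..<n} // signed_coset_rel n q"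
  note equiv = equiv_signed_coset_rel[OF n q(1)]
  \<comment> \<open>A function on the orbits is spread over the multiples of \<open>P\<close>; these
    vectors will be exactly the fixed ones.\<close>
  define \<Psi> :: "(nat set \<Rightarrow> 'a) \<Rightarrow> 'a vec" where
    "\<Psi> = (\<lambda>F. vec m (\<lambda>j. if P dvd j then F (?r `` {j div P}) else 0))"
  have m: "m > 0" using n P by (simp add: m_def)
  have cop: "coprime q n" "coprime (m - 1) n"
    using q coprime_diff_one_left_nat[OF m] by (simp_all add: coprime_commute m_def)
  have lt: "P * i < m" if "i < n" for i using that P by (simp add: m_def mult.commute)
  have \<Psi>_index: "\<Psi> F $ (P * i) = F (?r `` {i})" if "i < n" for F i
    using lt[OF that] P by (simp add: \<Psi>_def)
  have neg: "[int (m - 1) = - 1] (mod int n)"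
    using m by (simp add: cong_iff_dvd_diff of_nat_diff m_def)
  have step_q: "(i, q * i mod n) \<in> ?r" if "i < n" for i
    unfolding signed_coset_rel_iff using that n
    by (intro conjI exI[of _ 1] bexI[of _ 1]) (auto simp: cong_def zmod_int)
  have neg_mod: "[int ((m - 1) * i mod n) = - int i] (mod int n)" for i
    using cong_scalar_right[OF neg, of "int i"] by (simp add: zmod_int cong_def)
  have step_neg: "(i, (m - 1) * i mod n) \<in> ?r" if "i < n" for i
    unfolding signed_coset_rel_iff using that n neg_mod[of i]
    by (intro conjI exI[of _ 0] bexI[of _ "-1"]) auto
  \<comment> \<open>Invariance under \<open>q\<close> forces the support condition, and with it both
    fixed-point conditions reduce to conditions on residues modulo \<open>n\<close>.\<close>
  have B_iff: "x \<in> B \<longleftrightarrow> (\<forall>j<m. \<not> P dvd j \<longrightarrow> x $ j = 0) \<and>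
      (\<forall>i<n. x $ (P * (q * i mod n)) = x $ (P * i)) \<and>
      (\<forall>i<n. x $ (P * ((m - 1) * i mod n)) = x $ (P * i))" if x: "x \<in> carrier_vec m" for x
  proof -
    have "\<forall>j<m. \<not> P dvd j \<longrightarrow> x $ j = 0" if "dilate m q x = x"
      using dilate_fixed_supported[OF x that q(2)] by blast
    thus ?thesis
      using dilate_eq_self_iff[OF cop(1) _ x] dilate_eq_self_iff[OF cop(2) _ x] x unfolding B_def by blast
  qed
  have "bij_betw \<Psi> (?Q \<rightarrow>\<^sub>E UNIV) B"
  proof (rule bij_betw_imageI)
    show "inj_on \<Psi> (?Q \<rightarrow>\<^sub>E UNIV)"
    proof (rule inj_onI)
      fix F G assume F: "F \<in> ?Q \<rightarrow>\<^sub>E UNIV" and G: "G \<in> ?Q \<rightarrow>\<^sub>E UNIV" and eq: "\<Psi> F = \<Psi> G"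
      show "F = G"
      proof (rule PiE_ext[OF F G])
        fix X assume "X \<in> ?Q"
        then obtain i where "i < n" "X = ?r `` {i}" by (auto elim: quotientE)
        thus "F X = G X" using \<Psi>_index[of i F] \<Psi>_index[of i G] eq by simp
      qed
    qed
    show "\<Psi> ` (?Q \<rightarrow>\<^sub>E UNIV) = B"
    proof (intro equalityI subsetI)
      fix x assume "x \<in> \<Psi> ` (?Q \<rightarrow>\<^sub>E UNIV)"
      then obtain F where F: "x = \<Psi> F" by blast
      have "?r `` {q * i mod n} = ?r `` {i}" "?r `` {(m - 1) * i mod n} = ?r `` {i}" if "i < n" for i
        using equiv_class_eq[OF equiv step_q[OF that]] equiv_class_eq[OF equiv step_neg[OF that]] by auto
      moreover have "\<Psi> F \<in> carrier_vec m" "\<forall>j<m. \<not> P dvd j \<longrightarrow> \<Psi> F $ j = 0"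
        by (simp_all add: \<Psi>_def)
      ultimately show "x \<in> B"
        using n by (simp add: F B_iff \<Psi>_index)
    next
      fix x assume xB: "x \<in> B"
      hence x: "x \<in> carrier_vec m" by (simp add: B_def)
      have inv: "x $ (P * (q * i mod n)) = x $ (P * i)" "x $ (P * ((m - 1) * i mod n)) = x $ (P * i)"
        if "i < n" for i using xB that unfolding B_iff[OF x] by blast+
      have pow: "x $ (P * (q ^ t * i mod n)) = x $ (P * i)" if "i < n" for i t
      proof (induction t)
        case (Suc t)
        have "q ^ Suc t * i mod n = q * (q ^ t * i mod n) mod n"
          by (simp add: mod_mult_right_eq mult.assoc)
        thus ?case using inv(1)[of "q ^ t * i mod n"] Suc n by simp
      qed (use that in simp)
      \<comment> \<open>Invariance under the two generators spreads along the orbit: first the power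
        of \<open>q\<close>, then, for a negative sign, one step by \<open>m - 1\<close>.\<close>
      have const: "x $ (P * j) = x $ (P * i)" if ij: "(i, j) \<in> ?r" for i j
      proof -
        obtain t \<epsilon> where lt: "i < n" "j < n" and \<epsilon>: "\<epsilon> \<in> {1, -1 :: int}"
          and c: "[int j = \<epsilon> * int q ^ t * int i] (mod int n)"
          using ij unfolding signed_coset_rel_iff by blast
        let ?k = "q ^ t * i mod n"
        have k: "[int ?k = int q ^ t * int i] (mod int n)"
          by (simp add: zmod_int cong_def)
        show ?thesis
        proof (cases "\<epsilon> = 1")
          case True
          hence "[int j = int ?k] (mod int n)" using c cong_sym[OF k] by (auto intro: cong_trans)
          hence "j = ?k" using lt n by (simp add: cong_int_iff) (simp add: cong_def)
          thus ?thesis using pow[OF lt(1)] by simp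
        next
          case False
          hence "[int j = - (int q ^ t * int i)] (mod int n)" using c \<epsilon> by simp
          moreover have "[- (int q ^ t * int i) = - int ?k] (mod int n)"
            using cong_sym[OF k] by (simp add: cong_minus_minus_iff)
          ultimately have "[int j = int ((m - 1) * ?k mod n)] (mod int n)"
            using cong_sym[OF neg_mod[of ?k]] by (blast intro: cong_trans)
          hence "j = (m - 1) * ?k mod n" using lt n by (simp only: cong_int_iff) (simp add: cong_def)
          thus ?thesis using pow[OF lt(1)] inv(2)[of ?k] n by simp
        qed
      qed
      \<comment> \<open>The representative of each orbit is arbitrary, since \<open>const\<close>
        makes the value independent of it.\<close>
      define F where "F = restrict (\<lambda>X. x $ (P * (SOME i. i \<in> X))) ?Q"
      have "\<Psi> F = x"
      proof (rule eq_vecI)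
        fix j assume "j < dim_vec x"
        hence j: "j < m" using x by simp
        show "\<Psi> F $ j = x $ j"
        proof (cases "P dvd j")
          case True
          then obtain i where i: "j = P * i" by (elim dvdE)
          hence "i < n" using j P by (simp add: m_def mult.commute)
          hence "(i, i) \<in> ?r" using equiv by (auto simp: equiv_def refl_on_def)
          hence "(SOME l. l \<in> ?r `` {i}) \<in> ?r `` {i}" by (intro someI[of "\<lambda>l. l \<in> ?r `` {i}" i]) simp
          hence "x $ (P * (SOME l. l \<in> ?r `` {i})) = x $ (P * i)" by (intro const) simp
          moreover have "?r `` {i} \<in> ?Q" using \<open>i < n\<close> by (intro quotientI) simp
          ultimately show ?thesis using \<Psi>_index[OF \<open>i < n\<close>] by (simp add: i F_def)
        next
          case False
          thus ?thesis using j xB unfolding B_iff[OF x] by (simp add: \<Psi>_def)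
        qed
      qed (use x in \<open>simp add: \<Psi>_def\<close>)
      moreover have "F \<in> ?Q \<rightarrow>\<^sub>E UNIV" by (simp add: F_def)
      ultimately show "x \<in> \<Psi> ` (?Q \<rightarrow>\<^sub>E UNIV)" by blast
    qed
  qed
  hence "card B = card (?Q \<rightarrow>\<^sub>E (UNIV :: 'a set))" by (rule bij_betw_same_card[symmetric])
  also have "\<dots> = card (UNIV :: 'a set) ^ card ?Q"
    using finite_quotient[OF finite_lessThan equiv_type[OF equiv]] by (simp add: card_funcsetE)
  finally show ?thesis by (simp add: B_def)
qed

end

theorem corollary4p6:
  fixes p \<nu> n :: nat
  assumes "prime p" and "\<nu> > 0" and "n > 0" and "\<not> p dvd n"
    and "card (UNIV :: 'a::{field,finite} set) = p ^ \<nu>"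
  shows "\<forall>k::nat.
      card (ecd_cyclic_codes TYPE('a) (n * p ^ k)) = card (ecd_cyclic_codes TYPE('a) n) \<and>
      real (card (ecd_cyclic_codes TYPE('a) n)) =
        2 powr
          ((\<Sum>d | d dvd n. real (chi d (p ^ \<nu>)) * (real (totient d) / real (ord d (p ^ \<nu>))))
           + 1 / 2 * (\<Sum>d | d dvd n.
               (1 - real (chi d (p ^ \<nu>))) * (real (totient d) / real (ord d (p ^ \<nu>)))))"
proof -
  let ?q = "p ^ \<nu>"
  let ?M = "card ({..<n} // signed_coset_rel n ?q)"
  have p: "p \<ge> 2" using prime_ge_2_nat[OF assms(1)] .
  have q: "?q > 1" using p assms(2) by (intro one_less_power) auto
  have cop: "coprime n ?q"
    using assms(1,4) prime_imp_coprime coprime_commute by auto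
  have card: "card (ecd_cyclic_codes TYPE('a) (n * p ^ k)) = 2 ^ ?M" for k
  proof -
    have pos: "p ^ k > 0" "n * p ^ k > 0" using p assms(3) by auto
    have "p ^ k dvd ?q ^ k"
      using assms(2) by (simp add: dvd_power_same dvd_power)
    \<comment> \<open>The fixed subring has been counted twice. Comparing exponents of
      \<open>q\<close> identifies the unspecified \<open>r\<close> with the number of orbits modulo
      \<open>n\<close>, which does not involve \<open>k\<close>.\<close>
    from card_dilate_fixed[OF assms(3) pos(1) refl cop this, where ?'a = 'a]
      card_ecd_cyclic_codes[OF pos(2) assms(1,5,2)]
    obtain r where "?q ^ ?M = ?q ^ r" "card (ecd_cyclic_codes TYPE('a) (n * p ^ k)) = 2 ^ r"
      unfolding assms(5) by metis
    thus ?thesis using power_inject_exp[OF q] by metis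
  qed
  show ?thesis
    unfolding card_signed_cosets[OF assms(3) cop, symmetric]
    using card card[of 0] by (simp add: powr_realpow)
qed

end
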